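(* Let $P_1,\dots,P_n$ be p-values (random variables in $[0,1]$) and let $\boldsymbol\omega=(\omega_1,\dots,\omega_n)$ be non-random weights with $\omega_i>0$ and $\sum_{i=1}^n\omega_i=n$. Let $I_{\mathbf P}$ be the set of dominating signals of $\mathbf P=(P_1,\dots,P_n)$. Suppose that: (i) each $P_i$ is continuously distributed; (ii) the vector $(1-P_1,\dots,1-P_n)$ has an MRV copula; (iii) for any distinct $i,j\in I_{\mathbf P}$, $\lim_{t\downarrow0}\mathbb{P}(P_i<t)/\mathbb{P}(P_j<t)$ exists in $(0,\infty)$; and for at least one $i\in I_{\mathbf P}$ there exists $F_0\in\mathscr{R}_{-1}$ such that the distribution of $Q_{F_0}(1-P_i)$ belongs to $\mathscr{R}_{-\beta}$ for some $0<\beta\le1$. For each $\gamma>0$ let $F=F_\gamma\in\mathscr{R}^*_{-\gamma}$ be a transformation function with tail index $\gamma$. Then $$\lim_{\gamma\downarrow0}\lim_{\alpha\downarrow0}\frac{\mathbb{P}\left(P_{\mathrm{comb}}^{F_\gamma,\boldsymbol\omega}\le\alpha\right)}{\mathbb{P}\left(P_{\mathrm{bon}}^{\boldsymbol\omega}\le\alpha\right)}=1.$$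
   Context: The number $n$ of p-values is fixed; $\mathbb{P}$ is probability under the true configuration of hypotheses. For a CDF $F$, $\overline F=1-F$ and $Q_F(t)=\inf\{x\in\mathbb{R}:F(x)\ge t\}$ for $t\in(0,1)$; when the support of $F$ is $[c,\infty)$ set $Q_F(0)=c$. For $\gamma>0$, $\mathscr{R}_{-\gamma}$ is the class of CDFs $F$ with $\lim_{x\to\infty}\overline F(xy)/\overline F(x)=y^{-\gamma}$ for all $y>0$. $\mathscr{R}^*_{-\gamma}$ is the class of $F\in\mathscr{R}_{-\gamma}$ that are continuous and strictly increasing on their support, with support $[c,\infty)$ for some $c\in\mathbb{R}$. Weighted heavy-tailed combination test: for $F\in\mathscr{R}^*_{-\gamma}$, with $x^+=\max(0,x)$, $$\bar X_{n,\boldsymbol\omega}=\frac1n\sum_{i=1}^n Q_F\left((1-P_i/\omega_i)^+\right),\qquad P_{\mathrm{comb}}^{F,\boldsymbol\omega}=\min\left(1,\,n^{1-\gamma}\,\overline F(\bar X_{n,\boldsymbol\omega})\right).$$ Weighted Bonferroni test: $P_{\mathrm{bon}}^{\boldsymbol\omega}=\min\left(1,\,n\min_{i=1,\dots,n}P_i/\omega_i\right)$. Dominating signals: write $P_i\succ P_j$ if $\lim_{t\downarrow0}\mathbb{P}(P_i<t)/\mathbb{P}(P_j<t)=0$. Then $I_{\mathbf P}=\{i\in\{1,\dots,n\}:\text{there is no } j\in\{1,\dots,n\}\text{ with }P_i\succ P_j\}$. MRV copula: for an $n$-dimensional copula $C$ let $D(u_1,\dots,u_n)=1-C(1-u_1,\dots,1-u_n)$.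 $C$ is an MRV copula if for some (real-valued) function $\ell$, $\lim_{s\downarrow0}s^{-1}D(sv_1,\dots,sv_n)=\ell(v_1,\dots,v_n)$ for all $v_1,\dots,v_n\ge0$. *)

theory Defs
  imports "HOL-Probability.Probability"
begin

definition is_cdf :: "(real \<Rightarrow> real) \<Rightarrow> bool" where
  "is_cdf F \<longleftrightarrow> (\<exists>N. real_distribution N \<and> F = cdf N)"

definition law_cdf :: "'a measure \<Rightarrow> ('a \<Rightarrow> real) \<Rightarrow> real \<Rightarrow> real" where
  "law_cdf M X = cdf (distr M borel X)"

definition cdf_support :: "(real \<Rightarrow> real) \<Rightarrow> real set" where
  "cdf_support F = {x. \<forall>\<epsilon>>0. F (x - \<epsilon>) < F (x + \<epsilon>)}"

text \<open>Intended for \<open>0 < t < 1\<close>, and for \<open>t = 0\<close> when the support is \<open>[c, \<infinity>)\<close>, where the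
  value is \<open>c\<close>. All other values are junk; in particular \<open>t = 1\<close> stands for the value
  \<open>\<infinity>\<close> when \<open>F < 1\<close>. At p-values without atoms these arguments occur with probability 0.\<close>

definition quantile :: "(real \<Rightarrow> real) \<Rightarrow> real \<Rightarrow> real" where
  "quantile F t = (if t = 0 then Inf (cdf_support F) else Inf {x. t \<le> F x})"

text \<open>\<open>reg_varying \<gamma>\<close> is the class with index \<open>-\<gamma>\<close>. The limits are positive, so membership forces
  \<open>F x < 1\<close> for all \<open>x\<close>, and the division is never by zero.\<close>

definition reg_varying :: "real \<Rightarrow> (real \<Rightarrow> real) set" where
  "reg_varying \<gamma> = {F. is_cdf F \<and>
     (\<forall>y>0. ((\<lambda>x. (1 - F (x * y)) / (1 - F x)) \<longlongrightarrow> y powr (- \<gamma>)) at_top)}"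

definition reg_varying_star :: "real \<Rightarrow> (real \<Rightarrow> real) set" where
  "reg_varying_star \<gamma> = {F \<in> reg_varying \<gamma>.
     continuous_on (cdf_support F) F \<and> strict_mono_on (cdf_support F) F \<and>
     (\<exists>c. cdf_support F = {c..})}"

text \<open>In the tests below, \<open>p\<close> is a realisation of the p-values and \<open>n = CARD('n)\<close>.\<close>

definition comb_stat :: "(real \<Rightarrow> real) \<Rightarrow> ('n::finite \<Rightarrow> real) \<Rightarrow> ('n \<Rightarrow> real) \<Rightarrow> real" where
  "comb_stat F \<omega> p = (1 / real CARD('n)) * (\<Sum>i\<in>UNIV. quantile F (max 0 (1 - p i / \<omega> i)))"

definition P_comb :: "real \<Rightarrow> (real \<Rightarrow> real) \<Rightarrow> ('n::finite \<Rightarrow> real) \<Rightarrow> ('n \<Rightarrow> real) \<Rightarrow> real" where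
  "P_comb \<gamma> F \<omega> p = min 1 (real CARD('n) powr (1 - \<gamma>) * (1 - F (comb_stat F \<omega> p)))"

definition P_bon :: "('n::finite \<Rightarrow> real) \<Rightarrow> ('n \<Rightarrow> real) \<Rightarrow> real" where
  "P_bon \<omega> p = min 1 (real CARD('n) * (MIN i. p i / \<omega> i))"

text \<open>\<open>succ_pval M X Y\<close> is \<open>X \<succ> Y\<close> (\<open>Y\<close> is the stronger signal). The first conjunct makes the
  quotient meaningful; without it \<open>x / 0 = 0\<close> would make every \<open>X\<close> dominated by a \<open>Y\<close> that is
  bounded away from 0.\<close>

definition succ_pval :: "'a measure \<Rightarrow> ('a \<Rightarrow> real) \<Rightarrow> ('a \<Rightarrow> real) \<Rightarrow> bool" where
  "succ_pval M X Y \<longleftrightarrow>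
     (\<forall>t>0. measure M {x \<in> space M. Y x < t} > 0) \<and>
     ((\<lambda>t. measure M {x \<in> space M. X x < t} / measure M {x \<in> space M. Y x < t})
        \<longlongrightarrow> 0) (at_right 0)"

definition dominating :: "'a measure \<Rightarrow> ('n::finite \<Rightarrow> 'a \<Rightarrow> real) \<Rightarrow> 'n set" where
  "dominating M P = {i. \<not> (\<exists>j. succ_pval M (P i) (P j))}"

text \<open>A copula is a multivariate CDF with standard uniform margins, regarded as a function on
  \<open>[0,1]\<^sup>n\<close> only. The order on \<^typ>\<open>real^'n\<close> is componentwise.\<close>

definition is_copula :: "(real^'n::finite \<Rightarrow> real) \<Rightarrow> bool" where
  "is_copula C \<longleftrightarrow> (\<exists>N :: (real^'n) measure.
     prob_space N \<and> sets N = sets borel \<and>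
     (\<forall>i. distr N borel (\<lambda>x. x $ i) = uniform_measure lborel {0..1}) \<and>
     (\<forall>u. (\<forall>i. 0 \<le> u $ i \<and> u $ i \<le> 1) \<longrightarrow> C u = measure N {..u}))"

definition copula_of :: "'a measure \<Rightarrow> ('n::finite \<Rightarrow> 'a \<Rightarrow> real) \<Rightarrow> (real^'n \<Rightarrow> real) \<Rightarrow> bool" where
  "copula_of M X C \<longleftrightarrow> is_copula C \<and>
     (\<forall>x :: real^'n. measure M {w \<in> space M. \<forall>i. X i w \<le> x $ i}
        = C (\<chi> i. law_cdf M (X i) (x $ i)))"

definition copula_D :: "(real^'n::finite \<Rightarrow> real) \<Rightarrow> real^'n \<Rightarrow> real" where
  "copula_D C u = 1 - C (\<chi> i. 1 - u $ i)"

definition MRV_copula :: "(real^'n::finite \<Rightarrow> real) \<Rightarrow> bool" where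
  "MRV_copula C \<longleftrightarrow> is_copula C \<and>
     (\<exists>l :: real^'n \<Rightarrow> real. \<forall>v. (\<forall>i. 0 \<le> v $ i) \<longrightarrow>
        ((\<lambda>s. inverse s * copula_D C (s *\<^sub>R v)) \<longlongrightarrow> l v) (at_right 0))"

end

theory Submission
  imports Defs
begin

text \<open>
  Write \<open>G i\<close> for the lower tail of \<open>P i\<close>, and let \<open>i0\<close> be the dominating signal in the tail
  condition. The condition says that \<open>G i0\<close> is regularly varying at 0 with an index \<open>\<beta>\<close>
  (\<open>tail_index\<close>), and every other \<open>G i\<close> is asymptotic to a multiple \<open>c i \<ge> 0\<close> of \<open>G i0\<close>
  (\<open>relative_tail_tendsto\<close>). With the Lipschitz continuity of copulas the MRV property then gives
  the asymptotics of \<open>{\<exists>i. P i < t i}\<close> relative to \<open>G i0\<close> for all thresholds of a common order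
  (\<open>MRV_copula_tendsto\<close>). This settles the Bonferroni test, whose rejection event has exactly this
  form: its probability is asymptotically \<open>b * G i0 (\<alpha> / n)\<close> for some \<open>b > 0\<close>.

  The combination test rejects when the sum of \<open>X i = Q_F((1 - P i / \<omega> i)\<^sup>+)\<close> is large. Since
  \<open>X i > y\<close> iff \<open>P i < \<omega> i * (1 - F y)\<close>, the unions of events \<open>X i > x * y i\<close> have known
  asymptotics relative to \<open>g x = G i0 (1 - F x)\<close>, and so has every Boolean combination of such
  events that fails when none of them occurs (\<open>Boolean_combination_tendsto\<close>). Rounding the
  \<open>X i / x\<close> to a grid encloses the event that the sum exceeds \<open>x\<close> by such combinations, and
  the error is controlled by regular variation of \<open>g\<close>, with index \<open>- \<gamma> * \<beta>\<close>; so the probability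
  that the sum exceeds \<open>x\<close>, divided by \<open>g x\<close>, has a limit \<open>L\<close> (\<open>p_converges\<close>). No limit measure
  is needed. After matching the levels, the ratio of the rejection probabilities tends to
  \<open>L / b\<close> for fixed \<open>\<gamma>\<close>.

  Finally, a sum of at least \<open>x\<close> has a summand above \<open>x / (n + 1)\<close>, and a summand above \<open>2 * x\<close>
  makes the sum exceed \<open>x\<close> for large \<open>x\<close>. Thus
  \<open>2 powr - (\<gamma> * \<beta>) \<le> L / b \<le> (n + 1) powr (\<gamma> * \<beta>)\<close>, and both bounds tend to 1 as
  \<open>\<gamma> \<down> 0\<close>.
\<close>

section \<open>Sandwich and monotonicity arguments\<close>

text \<open>A sandwich in which the two bounds depend on a parameter \<open>r > 1\<close> and have limits \<open>U r\<close> and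
  \<open>V r\<close> that only meet at the common value \<open>L\<close> as \<open>r \<down> 1\<close>.\<close>

lemma tendsto_sandwich_family:
  fixes f :: "'b \<Rightarrow> real" and U V :: "real \<Rightarrow> real"
  assumes up: "\<And>r. r > 1 \<Longrightarrow> \<exists>u. (\<forall>\<^sub>F x in A. f x \<le> u x) \<and> (u \<longlongrightarrow> U r) A"
    and lo: "\<And>r. r > 1 \<Longrightarrow> \<exists>v. (\<forall>\<^sub>F x in A. v x \<le> f x) \<and> (v \<longlongrightarrow> V r) A"
    and U: "(U \<longlongrightarrow> L) (at_right 1)" and V: "(V \<longlongrightarrow> L) (at_right 1)"
  shows "(f \<longlongrightarrow> L) A"
proof (rule order_tendstoI)
  fix a assume "a < L"
  have "\<forall>\<^sub>F r in at_right 1. a < V r \<and> r > 1"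
    using order_tendstoD(1)[OF V \<open>a < L\<close>] by (simp add: eventually_conj_iff eventually_at_right_less)
  then obtain r where "a < V r" "r > 1"
    using eventually_happens'[of "at_right (1::real)"] by fastforce
  moreover obtain v where v: "\<forall>\<^sub>F x in A. v x \<le> f x" "(v \<longlongrightarrow> V r) A"
    using lo[OF \<open>r > 1\<close>] by blast
  ultimately show "\<forall>\<^sub>F x in A. a < f x"
    using eventually_elim2[OF v(1) order_tendstoD(1)[OF v(2)]] by (metis order_less_le_trans)
next
  fix a assume "L < a"
  have "\<forall>\<^sub>F r in at_right 1. U r < a \<and> r > 1"
    using order_tendstoD(2)[OF U \<open>L < a\<close>] by (simp add: eventually_conj_iff eventually_at_right_less)
  then obtain r where "U r < a" "r > 1"
    using eventually_happens'[of "at_right (1::real)"] by fastforce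
  moreover obtain u where u: "\<forall>\<^sub>F x in A. f x \<le> u x" "(u \<longlongrightarrow> U r) A"
    using up[OF \<open>r > 1\<close>] by blast
  ultimately show "\<forall>\<^sub>F x in A. f x < a"
    using eventually_elim2[OF u(1) order_tendstoD(2)[OF u(2)]] by (metis order_le_less_trans)
qed

text \<open>For monotone \<open>G\<close>, regular variation at 0 persists when the scaling factor is not constant but
  converges: it is eventually between \<open>s / l\<close> and \<open>s * l\<close> for every \<open>l > 1\<close>.\<close>

lemma regular_variation_compose:
  fixes G :: "real \<Rightarrow> real" and T r :: "'b \<Rightarrow> real"
  assumes mono: "mono G" and pos: "\<And>t. t > 0 \<Longrightarrow> G t > 0"
    and rv: "\<And>s. s > 0 \<Longrightarrow> ((\<lambda>t. G (t * s) / G t) \<longlongrightarrow> s powr \<beta>) (at_right 0)"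
    and T: "filterlim T (at_right 0) A" and r: "(r \<longlongrightarrow> s) A" and s: "s > 0"
  shows "((\<lambda>x. G (T x * r x) / G (T x)) \<longlongrightarrow> s powr \<beta>) A"
proof (rule tendsto_sandwich_family[where U = "\<lambda>l. (s * l) powr \<beta>" and V = "\<lambda>l. (s / l) powr \<beta>"])
  have Tpos: "\<forall>\<^sub>F x in A. T x > 0"
    using T by (auto simp: filterlim_at elim: eventually_mono)
  have lim: "((\<lambda>x. G (T x * y) / G (T x)) \<longlongrightarrow> y powr \<beta>) A" if "y > 0" for y
    using filterlim_compose[OF rv[OF that] T] .
  {
    fix l :: real assume l: "l > 1"
    have "\<forall>\<^sub>F x in A. r x < s * l"
      using order_tendstoD(2)[OF r, of "s * l"] l s by simp
    with Tpos have "\<forall>\<^sub>F x in A. G (T x * r x) / G (T x) \<le> G (T x * (s * l)) / G (T x)"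
      by eventually_elim (auto intro!: divide_right_mono monoD[OF mono] simp: less_imp_le[OF pos])
    with lim[of "s * l"] s l
    show "\<exists>u. (\<forall>\<^sub>F x in A. G (T x * r x) / G (T x) \<le> u x) \<and> (u \<longlongrightarrow> (s * l) powr \<beta>) A"
      by (intro exI[of _ "\<lambda>x. G (T x * (s * l)) / G (T x)"]) auto
    have "\<forall>\<^sub>F x in A. s / l < r x"
      using order_tendstoD(1)[OF r, of "s / l"] l s by (simp add: field_simps)
    with Tpos have "\<forall>\<^sub>F x in A. G (T x * (s / l)) / G (T x) \<le> G (T x * r x) / G (T x)"
    proof eventually_elim
      case (elim x)
      then have "T x * (s / l) \<le> T x * r x" by (intro mult_left_mono) auto
      then show ?case
        using elim by (intro divide_right_mono monoD[OF mono]) (auto simp: less_imp_le[OF pos])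
    qed
    with lim[of "s / l"] s l
    show "\<exists>v. (\<forall>\<^sub>F x in A. v x \<le> G (T x * r x) / G (T x)) \<and> (v \<longlongrightarrow> (s / l) powr \<beta>) A"
      by (intro exI[of _ "\<lambda>x. G (T x * (s / l)) / G (T x)"]) auto
  }
  show "((\<lambda>l. (s * l) powr \<beta>) \<longlongrightarrow> s powr \<beta>) (at_right 1)"
    using s by (auto intro!: tendsto_eq_intros)
  show "((\<lambda>l. (s / l) powr \<beta>) \<longlongrightarrow> s powr \<beta>) (at_right 1)"
    using s by (auto intro!: tendsto_eq_intros)
qed

text \<open>The bounds give, for every \<open>\<theta>\<close>, that \<open>limsup p \<le> a\<close> and \<open>a * \<theta> powr \<rho> \<le> liminf p\<close> with
  \<open>a = a \<theta>\<close>. The gap between the two closes as \<open>\<theta> \<up> 1\<close>, because \<open>p\<close> is bounded.\<close>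

lemma self_similar_sandwich_converges:
  fixes p :: "real \<Rightarrow> real"
  assumes bound: "\<forall>\<^sub>F x in at_top. p x \<le> B"
    and nonneg: "\<And>x. 0 \<le> p x"
    and sandwich: "\<And>\<theta>. 0 < \<theta> \<Longrightarrow> \<theta> < 1 \<Longrightarrow> \<exists>q h a. (\<forall>\<^sub>F x in at_top. p x \<le> q x) \<and>
      (\<forall>\<^sub>F x in at_top. q x \<le> p (\<theta> * x) * h x) \<and> (q \<longlongrightarrow> a) at_top \<and>
      (h \<longlongrightarrow> \<theta> powr - \<rho>) at_top"
  shows "\<exists>L. (p \<longlongrightarrow> L) at_top"
proof -
  have "\<exists>a. \<forall>\<epsilon>>0. (\<forall>\<^sub>F x in at_top. p x < a + \<epsilon>) \<and>
      (\<forall>\<^sub>F x in at_top. a * \<theta> powr \<rho> - \<epsilon> < p x)" if \<theta>: "0 < \<theta>" "\<theta> < 1" for \<theta>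
  proof -
    obtain q h a where q: "\<forall>\<^sub>F x in at_top. p x \<le> q x"
      "\<forall>\<^sub>F x in at_top. q x \<le> p (\<theta> * x) * h x" "(q \<longlongrightarrow> a) at_top"
      "(h \<longlongrightarrow> \<theta> powr - \<rho>) at_top"
      using sandwich[OF \<theta>] by blast
    have h: "\<forall>\<^sub>F x in at_top. h x > 0"
      using order_tendstoD(1)[OF q(4), of 0] \<theta> by simp
    have sc: "filterlim (\<lambda>x. x * inverse \<theta>) at_top at_top"
      using \<theta> by (intro filterlim_at_top_mult_tendsto_pos[OF tendsto_const _ filterlim_ident]) auto
    have "((\<lambda>x. q x / h x) \<longlongrightarrow> a / \<theta> powr - \<rho>) at_top"
      using \<theta> by (intro tendsto_divide q) auto
    then have lim: "((\<lambda>x. q x / h x) \<longlongrightarrow> a * \<theta> powr \<rho>) at_top"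
      by (simp add: powr_minus divide_inverse)
    have "\<forall>\<^sub>F x in at_top. q x / h x \<le> p (\<theta> * x)"
      using q(2) h by eventually_elim (simp add: field_simps)
    from eventually_compose_filterlim[OF this sc]
    have lo: "\<forall>\<^sub>F x in at_top. q (x * inverse \<theta>) / h (x * inverse \<theta>) \<le> p x"
      using \<theta> by (simp add: field_simps)
    show ?thesis
    proof (intro exI[of _ a] allI impI conjI)
      fix \<epsilon> :: real assume "\<epsilon> > 0"
      show "\<forall>\<^sub>F x in at_top. p x < a + \<epsilon>"
        using q(1) order_tendstoD(2)[OF q(3), of "a + \<epsilon>"] \<open>\<epsilon> > 0\<close>
        by (auto elim: eventually_elim2)
      have "\<forall>\<^sub>F x in at_top. a * \<theta> powr \<rho> - \<epsilon> < q (x * inverse \<theta>) / h (x * inverse \<theta>)"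
        using order_tendstoD(1)[OF filterlim_compose[OF lim sc], of "a * \<theta> powr \<rho> - \<epsilon>"] \<open>\<epsilon> > 0\<close> by simp
      with lo show "\<forall>\<^sub>F x in at_top. a * \<theta> powr \<rho> - \<epsilon> < p x"
        by eventually_elim simp
    qed
  qed
  then have "\<forall>\<theta>\<in>{0<..<1}. \<exists>a. \<forall>\<epsilon>>0. (\<forall>\<^sub>F x in at_top. p x < a + \<epsilon>) \<and>
      (\<forall>\<^sub>F x in at_top. a * \<theta> powr \<rho> - \<epsilon> < p x)" by simp
  from bchoice[OF this] obtain a where a: "\<forall>\<theta>\<in>{0<..<1}. \<forall>\<epsilon>>0.
      (\<forall>\<^sub>F x in at_top. p x < a \<theta> + \<epsilon>) \<and> (\<forall>\<^sub>F x in at_top. a \<theta> * \<theta> powr \<rho> - \<epsilon> < p x)" ..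
  have up: "\<forall>\<^sub>F x in at_top. p x < a \<theta> + \<epsilon>"
    and lo: "\<forall>\<^sub>F x in at_top. a \<theta> * \<theta> powr \<rho> - \<epsilon> < p x" if "0 < \<theta>" "\<theta> < 1" "\<epsilon> > 0" for \<theta> \<epsilon>
    using a that by auto
  have le: "a \<theta> * \<theta> powr \<rho> \<le> a \<theta>'" if "0 < \<theta>" "\<theta> < 1" "0 < \<theta>'" "\<theta>' < 1" for \<theta> \<theta>'
  proof (rule field_le_epsilon)
    fix e :: real assume "e > 0"
    then have "\<forall>\<^sub>F x in at_top. p x < a \<theta>' + e/2 \<and> a \<theta> * \<theta> powr \<rho> - e/2 < p x"
      using up[of \<theta>' "e/2"] lo[of \<theta> "e/2"] that by (simp add: eventually_conj_iff)
    then obtain x where "p x < a \<theta>' + e/2" "a \<theta> * \<theta> powr \<rho> - e/2 < p x"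
      using eventually_happens'[OF trivial_limit_at_top_linorder] by blast
    then show "a \<theta> * \<theta> powr \<rho> \<le> a \<theta>' + e" by linarith
  qed
  have a_nonneg: "0 \<le> a \<theta>" if "0 < \<theta>" "\<theta> < 1" for \<theta>
  proof (rule field_le_epsilon)
    fix e :: real assume "e > 0"
    from eventually_happens'[OF trivial_limit_at_top_linorder up[OF that this]]
    obtain x where "p x < a \<theta> + e" by blast
    with nonneg[of x] show "0 \<le> a \<theta> + e" by linarith
  qed
  define L where "L = (INF \<theta>\<in>{0<..<1}. a \<theta>)"
  have "1/2 \<in> {0<..<1::real}" by simp
  then have ne: "{0<..<1::real} \<noteq> {}" by blast
  have bdd: "bdd_below (a ` {0<..<1})"
    using a_nonneg by (intro bdd_belowI2[of _ 0]) auto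
  have L1: "L \<le> a \<theta>" if "0 < \<theta>" "\<theta> < 1" for \<theta>
    unfolding L_def using that by (intro cINF_lower bdd) auto
  have L2: "a \<theta> * \<theta> powr \<rho> \<le> L" if "0 < \<theta>" "\<theta> < 1" for \<theta>
    unfolding L_def using that le ne by (intro cINF_greatest) auto
  have aB: "a \<theta> * \<theta> powr \<rho> \<le> B" if "0 < \<theta>" "\<theta> < 1" for \<theta>
  proof (rule field_le_epsilon)
    fix e :: real assume "e > 0"
    then have "\<forall>\<^sub>F x in at_top. a \<theta> * \<theta> powr \<rho> - e < p x \<and> p x \<le> B"
      using lo[of \<theta> e] that bound by (simp add: eventually_conj_iff)
    then obtain x where "a \<theta> * \<theta> powr \<rho> - e < p x" "p x \<le> B"
      using eventually_happens'[OF trivial_limit_at_top_linorder] by blast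
    then show "a \<theta> * \<theta> powr \<rho> \<le> B + e" by linarith
  qed
  have "(p \<longlongrightarrow> L) at_top"
  proof (rule tendstoI)
    fix e :: real assume e: "e > 0"
    have "((\<lambda>\<theta>. B * \<bar>\<theta> powr - \<rho> - 1\<bar>) \<longlongrightarrow> 0) (at_left 1)"
      by (auto intro!: tendsto_eq_intros)
    then have "\<forall>\<^sub>F \<theta> in at_left 1. B * \<bar>\<theta> powr - \<rho> - 1\<bar> < e / 2"
      using e by (intro order_tendstoD(2)) auto
    moreover have "\<forall>\<^sub>F \<theta> in at_left 1. 0 < \<theta> \<and> \<theta> < (1::real)"
      using eventually_at_left_real[of 0 "1::real"] by (auto elim: eventually_mono)
    ultimately have "\<forall>\<^sub>F \<theta> in at_left 1. B * \<bar>\<theta> powr - \<rho> - 1\<bar> < e / 2 \<and> 0 < \<theta> \<and> \<theta> < 1"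
      by eventually_elim simp
    then obtain \<theta> where th: "B * \<bar>\<theta> powr - \<rho> - 1\<bar> < e / 2" "0 < \<theta>" "\<theta> < 1"
      using eventually_happens'[OF trivial_limit_at_left_real[of 1]] by blast
    define b where "b = a \<theta> * \<theta> powr \<rho>"
    have b: "0 \<le> b" "b \<le> B" "b \<le> L" "L \<le> a \<theta>"
      using a_nonneg[OF th(2,3)] aB[OF th(2,3)] L1[OF th(2,3)] L2[OF th(2,3)] by (auto simp: b_def)
    have "a \<theta> - b = b * (\<theta> powr - \<rho> - 1)"
      using th by (simp add: b_def powr_minus field_simps)
    also have "\<dots> \<le> B * \<bar>\<theta> powr - \<rho> - 1\<bar>"
      using b by (smt (verit) mult_mono mult_left_mono)
    finally have "a \<theta> - b < e / 2" using th by simp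
    moreover have "\<forall>\<^sub>F x in at_top. p x < a \<theta> + e / 2 \<and> b - e / 2 < p x"
      using up[OF th(2,3), of "e/2"] lo[OF th(2,3), of "e/2"] e
      by (simp add: b_def eventually_conj_iff)
    ultimately show "\<forall>\<^sub>F x in at_top. dist (p x) L < e"
      using b(3,4) by (auto elim!: eventually_mono simp: dist_real_def)
  qed
  then show ?thesis ..
qed

section \<open>Distribution functions with a regularly varying tail\<close>

lemma is_cdfE:
  assumes "is_cdf F"
  obtains N where "real_distribution N" "F = cdf N"
  using assms unfolding is_cdf_def by blast

lemma is_cdf_mono: "is_cdf F \<Longrightarrow> x \<le> y \<Longrightarrow> F x \<le> F y"
  by (elim is_cdfE) (simp add: real_distribution.finite_borel_measure_M finite_borel_measure.cdf_nondecreasing)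

lemma is_cdf_le_1: "is_cdf F \<Longrightarrow> F x \<le> 1"
  by (elim is_cdfE) (simp add: real_distribution.cdf_bounded_prob)

lemma is_cdf_nonneg: "is_cdf F \<Longrightarrow> 0 \<le> F x"
  by (elim is_cdfE) (simp add: real_distribution.finite_borel_measure_M finite_borel_measure.cdf_nonneg)

lemma is_cdf_at_top: "is_cdf F \<Longrightarrow> (F \<longlongrightarrow> 1) at_top"
  by (elim is_cdfE) (simp add: real_distribution.cdf_lim_at_top_prob)

lemma is_cdf_at_bot: "is_cdf F \<Longrightarrow> (F \<longlongrightarrow> 0) at_bot"
  by (elim is_cdfE) (simp add: real_distribution.finite_borel_measure_M finite_borel_measure.cdf_lim_at_bot)

lemma is_cdf_right_cont: "is_cdf F \<Longrightarrow> continuous (at_right a) F"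
  by (elim is_cdfE) (simp add: real_distribution.finite_borel_measure_M finite_borel_measure.cdf_is_right_cont)

lemma reg_varying_less_1:
  assumes "F \<in> reg_varying \<gamma>"
  shows "F x < 1"
proof (rule ccontr)
  assume "\<not> F x < 1"
  have F: "is_cdf F" using assms by (simp add: reg_varying_def)
  have one: "F y = 1" if "y \<ge> x" for y
    using is_cdf_mono[OF F that] is_cdf_le_1[OF F, of y] \<open>\<not> F x < 1\<close> by simp
  have lim: "((\<lambda>x. (1 - F (x * 1)) / (1 - F x)) \<longlongrightarrow> 1 powr (- \<gamma>)) at_top"
    using assms unfolding reg_varying_def by (blast intro: zero_less_one)
  have "\<forall>\<^sub>F y in at_top. (1 - F (y * 1)) / (1 - F y) = 0"
    using eventually_ge_at_top[of x] by eventually_elim (simp add: one)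
  then have "((\<lambda>x. (1 - F (x * 1)) / (1 - F x)) \<longlongrightarrow> 0) at_top"
    by (rule tendsto_eventually)
  from tendsto_unique[OF _ lim this] show False by simp
qed

lemma reg_varying_tail_at_right_0:
  assumes "F \<in> reg_varying \<gamma>"
  shows "filterlim (\<lambda>x. 1 - F x) (at_right 0) at_top"
  unfolding filterlim_at
proof
  show "((\<lambda>x. 1 - F x) \<longlongrightarrow> 0) at_top"
    using is_cdf_at_top[of F] assms by (auto intro!: tendsto_eq_intros simp: reg_varying_def)
  show "\<forall>\<^sub>F x in at_top. 1 - F x \<in> {0<..} \<and> 1 - F x \<noteq> 0"
    using reg_varying_less_1[OF assms] by (intro always_eventually) (auto simp: less_le)
qed

lemma less_quantile_iff:
  assumes F: "is_cdf F" and t: "0 < t" "t < 1"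
  shows "x < quantile F t \<longleftrightarrow> F x < t"
proof -
  let ?A = "{y. t \<le> F y}"
  have q: "quantile F t = Inf ?A" using t by (simp add: quantile_def)
  have "\<forall>\<^sub>F y in at_bot. F y < t"
    using order_tendstoD(2)[OF is_cdf_at_bot[OF F] t(1)] .
  then obtain y0 where y0: "F y0 < t"
    using eventually_happens'[OF trivial_limit_at_bot_linorder] by blast
  have bdd: "bdd_below ?A"
  proof (rule bdd_belowI[of _ y0])
    fix y assume "y \<in> ?A"
    then show "y0 \<le> y" using is_cdf_mono[OF F, of y y0] y0 by fastforce
  qed
  have "\<forall>\<^sub>F y in at_top. t < F y"
    using order_tendstoD(1)[OF is_cdf_at_top[OF F] t(2)] .
  then obtain y1 where y1: "t < F y1"
    using eventually_happens'[OF trivial_limit_at_top_linorder] by blast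
  then have ne: "?A \<noteq> {}" by (auto intro: less_imp_le)
  show ?thesis
  proof
    assume "x < quantile F t"
    then show "F x < t"
      using cInf_lower[OF _ bdd, of x] by (force simp: q)
  next
    assume x: "F x < t"
    have "\<forall>\<^sub>F y in at_right x. F y < t"
      using order_tendstoD(2)[OF is_cdf_right_cont[OF F, unfolded continuous_within] x] .
    then obtain z where z: "z > x" "\<And>y. x < y \<Longrightarrow> y < z \<Longrightarrow> F y < t"
      by (auto simp: eventually_at_right_field)
    define y where "y = (x + z) / 2"
    have y: "x < y" "F y < t" using z by (auto simp: y_def)
    have "y \<le> Inf ?A"
    proof (rule cInf_greatest[OF ne])
      fix w assume "w \<in> ?A"
      then show "y \<le> w" using is_cdf_mono[OF F, of w y] y by force
    qed
    then show "x < quantile F t" using y by (simp add: q)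
  qed
qed

lemma measurable_quantile:
  assumes F: "is_cdf F" and T: "T \<in> borel_measurable M"
    and range: "\<And>w. w \<in> space M \<Longrightarrow> 0 \<le> T w \<and> T w \<le> 1"
  shows "(\<lambda>w. quantile F (T w)) \<in> borel_measurable M"
proof (subst borel_measurable_iff_greater, rule allI)
  fix a
  have "{w \<in> space M. a < quantile F (T w)} =
      {w \<in> space M. T w = 0 \<and> a < quantile F 0 \<or> T w = 1 \<and> a < quantile F 1 \<or>
        0 < T w \<and> T w < 1 \<and> F a < T w}"
  proof (rule Collect_cong, rule conj_cong[OF refl])
    fix w assume "w \<in> space M"
    then consider "T w = 0" | "T w = 1" | "0 < T w" "T w < 1"
      using range[of w] by fastforce
    then show "(a < quantile F (T w)) = (T w = 0 \<and> a < quantile F 0 \<or>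
        T w = 1 \<and> a < quantile F 1 \<or> 0 < T w \<and> T w < 1 \<and> F a < T w)"
      by cases (simp_all add: less_quantile_iff[OF F])
  qed
  also have "\<dots> \<in> sets M" using T by measurable
  finally show "{w \<in> space M. a < quantile F (T w)} \<in> sets M" .
qed

text \<open>If \<open>F\<close> has support \<open>[c, \<infinity>)\<close> it is locally constant to the left of \<open>c\<close>, hence constant
  there, and its limit at \<open>-\<infinity>\<close> is 0.\<close>

lemma cdf_support_lower:
  assumes F: "is_cdf F" and supp: "cdf_support F = {c..}" and x: "x < c"
  shows "F x = 0"
proof -
  have "(F has_field_derivative 0) (at y within {..<c})" if "y \<in> {..<c}" for y
  proof -
    have "y \<notin> cdf_support F" using that supp by simp
    then obtain e where e: "e > 0" "\<not> F (y - e) < F (y + e)"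
      by (auto simp: cdf_support_def)
    have const: "F y = F z" if "z \<in> ball y e" for z
    proof -
      have "y - e \<le> z" "z \<le> y + e" using that by (auto simp: dist_real_def)
      then have "F (y - e) \<le> F z" "F z \<le> F (y + e)" "F (y - e) \<le> F y" "F y \<le> F (y + e)"
        using e by (auto intro!: is_cdf_mono[OF F])
      then show ?thesis using e by linarith
    qed
    have "y \<in> ball y e" using e(1) by simp
    then have "(F has_field_derivative 0) (at y)"
      by (rule has_field_derivative_transform_within_open[OF DERIV_const open_ball _ const])
    then show ?thesis by (rule has_field_derivative_at_within)
  qed
  then obtain k where k: "\<And>y. y < c \<Longrightarrow> F y = k"
    using has_field_derivative_zero_constant[of "{..<c}" F] by auto
  have "\<forall>\<^sub>F y in at_bot. F y = k"
    using eventually_le_at_bot[of "c - 1"] by eventually_elim (simp add: k)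
  then have "(F \<longlongrightarrow> k) at_bot" by (rule tendsto_eventually)
  then have "k = 0" using tendsto_unique[OF _ _ is_cdf_at_bot[OF F]] by simp
  then show ?thesis using k x by simp
qed

lemma quantile_star_ge:
  assumes F: "is_cdf F" and supp: "cdf_support F = {c..}" and t: "0 \<le> t" "t < 1"
  shows "c \<le> quantile F t"
proof (cases "t = 0")
  case True
  then show ?thesis by (simp add: quantile_def supp)
next
  case False
  show ?thesis
  proof (rule ccontr)
    assume "\<not> c \<le> quantile F t"
    then obtain y where "quantile F t < y" "y < c" using dense[of "quantile F t" c] by auto
    then show False
      using less_quantile_iff[OF F, of t y] cdf_support_lower[OF F supp, of y] t False by simp
  qed
qed

lemma less_quantile_star_iff:
  assumes F: "is_cdf F" and supp: "cdf_support F = {c..}" and t: "t < 1" and y: "c \<le> y"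
  shows "y < quantile F (max 0 t) \<longleftrightarrow> F y < t"
proof (cases "t > 0")
  case True
  then show ?thesis using less_quantile_iff[OF F _ t] by simp
next
  case False
  have "quantile F 0 = c" by (simp add: quantile_def supp)
  then show ?thesis using False is_cdf_nonneg[OF F, of y] y by (simp add: max_def)
qed

section \<open>Tail index of a p-value\<close>

text \<open>Passing to \<open>Q_F0(1 - P)\<close> only changes the scale on which the lower tail \<open>G\<close> of a p-value
  is measured: the survival function of \<open>Q_F0(1 - P)\<close> is \<open>G \<circ> (1 - F0)\<close>.\<close>

lemma tail_index_of_quantile_tail:
  fixes G F0 H :: "real \<Rightarrow> real"
  assumes F0: "F0 \<in> reg_varying 1" and H: "H \<in> reg_varying \<beta>"
    and HG: "\<And>x. 1 - H x = G (1 - F0 x)"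
    and mono: "mono G"
  shows "t > 0 \<Longrightarrow> G t > 0"
    and "s > 0 \<Longrightarrow> ((\<lambda>t. G (t * s) / G t) \<longlongrightarrow> s powr \<beta>) (at_right 0)"
proof -
  have F0c: "is_cdf F0" using F0 by (simp add: reg_varying_def)
  have G_pos: "G t > 0" if "t > 0" for t
  proof -
    have "\<forall>\<^sub>F x in at_top. 1 - F0 x < t"
      using reg_varying_tail_at_right_0[OF F0] that
      by (intro order_tendstoD(2)[of _ 0]) (auto simp: filterlim_at)
    then obtain x where "1 - F0 x < t"
      using eventually_happens'[OF trivial_limit_at_top_linorder] by blast
    then have "G (1 - F0 x) \<le> G t" by (intro monoD[OF mono]) simp
    then show ?thesis using reg_varying_less_1[OF H, of x] HG[of x] by linarith
  qed
  then show "t > 0 \<Longrightarrow> G t > 0" .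
  assume s: "s > 0"
  \<comment> \<open>As \<open>F0\<close> need not be continuous, \<open>t\<close> is only bracketed by values of \<open>1 - F0\<close> near \<open>X t\<close>;
    by regular variation the bracket is tight up to a factor close to 1.\<close>
  define X where "X t = quantile F0 (1 - t)" for t
  have X_less: "y < X t \<longleftrightarrow> t < 1 - F0 y" if "0 < t" "t < 1" for t y
    using less_quantile_iff[OF F0c, of "1 - t" y] that by (auto simp: X_def)
  have small: "\<forall>\<^sub>F t in at_right 0. 0 < t \<and> t < (1::real)"
    using eventually_at_right_real[of 0 "1::real"] by (auto elim: eventually_mono)
  have X_top: "filterlim X at_top (at_right 0)"
    unfolding filterlim_at_top
  proof
    fix B
    have "\<forall>\<^sub>F t in at_right 0. t \<in> {0<..<1 - F0 B}"
      using reg_varying_less_1[OF F0, of B] by (intro eventually_at_right_real) simp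
    with small show "\<forall>\<^sub>F t in at_right 0. B \<le> X t"
      by eventually_elim (auto intro: less_imp_le simp: X_less)
  qed
  have Xpos: "\<forall>\<^sub>F t in at_right 0. X t > 0"
    using X_top by (auto simp: filterlim_at_top_dense)
  have scale: "filterlim (\<lambda>t. X t * y) at_top (at_right 0)" if "y > 0" for y
    using filterlim_at_top_mult_tendsto_pos[OF tendsto_const that X_top] .
  have rvF0: "((\<lambda>x. (1 - F0 (x * y)) / (1 - F0 x)) \<longlongrightarrow> y powr (- 1)) at_top" if "y > 0" for y
    using F0 that by (simp add: reg_varying_def)
  have rvH: "((\<lambda>x. (1 - H (x * y)) / (1 - H x)) \<longlongrightarrow> y powr (- \<beta>)) at_top" if "y > 0" for y
    using H that by (simp add: reg_varying_def)
  have Hlim: "((\<lambda>t. (1 - H (X t * y)) / (1 - H (X t * z))) \<longlongrightarrow> (y / z) powr (- \<beta>)) (at_right 0)"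
    if "y > 0" "z > 0" for y z
    using filterlim_compose[OF rvH[of "y / z"] scale[OF that(2)]] that by simp
  show "((\<lambda>t. G (t * s) / G t) \<longlongrightarrow> s powr \<beta>) (at_right 0)"
  proof (rule tendsto_sandwich_family[where U = "\<lambda>l. (1 / (l * l * s)) powr (- \<beta>)"
        and V = "\<lambda>l. (l * l / s) powr (- \<beta>)"])
    fix l :: real assume l: "l > 1"
    have lt: "1 / l < (1::real)" "l > 0" using l by auto
    have brackets: "\<forall>\<^sub>F t in at_right 0. 1 - F0 (X t) \<le> t \<and> t < 1 - F0 (X t * (1 / l))"
      using small Xpos
    proof eventually_elim
      case (elim t)
      have "X t * (1 / l) < X t * 1" using elim lt by (intro mult_strict_left_mono) auto
      then show ?case using X_less[of t "X t"] X_less[of t "X t * (1 / l)"] elim by auto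
    qed
    have "\<forall>\<^sub>F t in at_right 0. s < (1 - F0 (X t * (1 / l) * (1 / (l * s)))) / (1 - F0 (X t * (1 / l)))"
      using filterlim_compose[OF rvF0[of "1 / (l * s)"] scale[of "1 / l"]] l s
      by (intro order_tendstoD(1)[of _ "l * s"]) (auto simp: powr_minus)
    then have step1: "\<forall>\<^sub>F t in at_right 0. s * (1 - F0 (X t * (1 / l))) < 1 - F0 (X t * (1 / (l * l * s)))"
      by eventually_elim (use reg_varying_less_1[OF F0] in \<open>simp add: field_simps\<close>)
    have "\<forall>\<^sub>F t in at_right 0. G (t * s) / G t \<le> (1 - H (X t * (1 / (l * l * s)))) / (1 - H (X t * 1))"
      using small brackets step1
    proof eventually_elim
      case (elim t)
      have "t * s \<le> s * (1 - F0 (X t * (1 / l)))" using elim s by simp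
      then have "G (t * s) \<le> 1 - H (X t * (1 / (l * l * s)))"
        using elim by (subst HG, intro monoD[OF mono]) linarith
      moreover have "1 - H (X t * 1) \<le> G t"
        using elim by (subst HG, intro monoD[OF mono]) simp
      moreover have "0 < 1 - H (X t * 1)" using reg_varying_less_1[OF H, of "X t * 1"] by simp
      ultimately show ?case
        using G_pos[of "t * s"] elim s by (intro frac_le) auto
    qed
    with Hlim[of "1 / (l * l * s)" 1] l s
    show "\<exists>u. (\<forall>\<^sub>F t in at_right 0. G (t * s) / G t \<le> u t) \<and> (u \<longlongrightarrow> (1 / (l * l * s)) powr (- \<beta>)) (at_right 0)"
      by (intro exI[of _ "\<lambda>t. (1 - H (X t * (1 / (l * l * s)))) / (1 - H (X t * 1))"]) auto
    have "\<forall>\<^sub>F t in at_right 0. (1 - F0 (X t * (l / s))) / (1 - F0 (X t)) < s"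
      using filterlim_compose[OF rvF0[of "l / s"] X_top] l s
      by (intro order_tendstoD(2)[of _ "s / l"]) (auto simp: powr_minus field_simps)
    then have step2: "\<forall>\<^sub>F t in at_right 0. 1 - F0 (X t * (l / s)) < s * (1 - F0 (X t))"
      by eventually_elim (use reg_varying_less_1[OF F0] in \<open>simp add: field_simps\<close>)
    have "\<forall>\<^sub>F t in at_right 0. (1 - H (X t * (l / s))) / (1 - H (X t * (1 / l))) \<le> G (t * s) / G t"
      using small brackets step2
    proof eventually_elim
      case (elim t)
      have "s * (1 - F0 (X t)) \<le> t * s" using elim s by simp
      then have "1 - H (X t * (l / s)) \<le> G (t * s)"
        using elim by (subst HG, intro monoD[OF mono]) linarith
      moreover have "G t \<le> 1 - H (X t * (1 / l))"
        using elim by (subst HG, intro monoD[OF mono]) simp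
      moreover have "0 < 1 - H (X t * (l / s))" using reg_varying_less_1[OF H, of "X t * (l / s)"] by simp
      ultimately show ?case
        using G_pos[of t] elim s by (intro frac_le) auto
    qed
    with Hlim[of "l / s" "1 / l"] l s
    show "\<exists>v. (\<forall>\<^sub>F t in at_right 0. v t \<le> G (t * s) / G t) \<and> (v \<longlongrightarrow> (l * l / s) powr (- \<beta>)) (at_right 0)"
      by (intro exI[of _ "\<lambda>t. (1 - H (X t * (l / s))) / (1 - H (X t * (1 / l)))"]) (auto simp: field_simps)
  next
    have e: "(1 / s) powr (- \<beta>) = s powr \<beta>"
      using s by (simp add: powr_minus powr_divide)
    have "((\<lambda>l. (1 / (l * l * s)) powr (- \<beta>)) \<longlongrightarrow> (1 / (1 * 1 * s)) powr (- \<beta>)) (at_right 1)"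
      using s by (intro tendsto_intros) auto
    then show "((\<lambda>l. (1 / (l * l * s)) powr (- \<beta>)) \<longlongrightarrow> s powr \<beta>) (at_right 1)"
      by (simp add: e)
    have "((\<lambda>l. (l * l / s) powr (- \<beta>)) \<longlongrightarrow> (1 * 1 / s) powr (- \<beta>)) (at_right 1)"
      using s by (intro tendsto_intros) auto
    then show "((\<lambda>l. (l * l / s) powr (- \<beta>)) \<longlongrightarrow> s powr \<beta>) (at_right 1)"
      by (simp add: e)
  qed
qed

section \<open>Unions of tail events under an MRV copula\<close>

text \<open>Two boxes differ by at most one slab in each coordinate, whose measure is given by the uniform
  margin.\<close>

lemma is_copula_increment:
  fixes C :: "real^'n::finite \<Rightarrow> real"
  assumes C: "is_copula C"
    and u: "\<And>i. 0 \<le> u $ i \<and> u $ i \<le> 1" and v: "\<And>i. 0 \<le> v $ i \<and> v $ i \<le> 1"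
  shows "C u - C v \<le> (\<Sum>i\<in>UNIV. \<bar>u $ i - v $ i\<bar>)"
proof -
  obtain N :: "(real^'n) measure" where N: "prob_space N" and sets: "sets N = sets borel"
    and marg: "\<And>i. distr N borel (\<lambda>x. x $ i) = uniform_measure lborel {0..1}"
    and CN: "\<And>u. (\<And>i. 0 \<le> u $ i \<and> u $ i \<le> 1) \<Longrightarrow> C u = measure N {..u}"
    using C unfolding is_copula_def by metis
  interpret prob_space N by fact
  have meas[measurable]: "(\<lambda>x. x $ i) \<in> borel_measurable N" for i
    by (subst measurable_cong_sets[OF sets refl]) measurable
  have space: "space N = UNIV" using sets_eq_imp_space_eq[OF sets] by simp
  have box: "{..w} \<in> sets N" for w unfolding sets by simp
  have slab: "{x. v $ i < x $ i \<and> x $ i \<le> u $ i} \<in> sets N" for i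
  proof -
    have "{x \<in> space N. v $ i < x $ i \<and> x $ i \<le> u $ i} \<in> sets N" by measurable
    then show ?thesis by (simp add: space)
  qed
  have slab_measure: "measure N {x. v $ i < x $ i \<and> x $ i \<le> u $ i} \<le> \<bar>u $ i - v $ i\<bar>" for i
  proof -
    have "measure N {x. v $ i < x $ i \<and> x $ i \<le> u $ i}
        = measure (distr N borel (\<lambda>x. x $ i)) {v $ i<..u $ i}"
      by (subst measure_distr) (auto simp: space intro!: arg_cong[where f = "measure N"])
    also have "\<dots> = measure lborel ({0..1} \<inter> {v $ i<..u $ i}) / measure lborel {0..1::real}"
      unfolding marg by (rule measure_uniform_measure) auto
    also have "{0..1} \<inter> {v $ i<..u $ i} = {v $ i<..u $ i}"
      using u[of i] v[of i] by auto
    also have "measure lborel \<dots> / measure lborel {0..1::real} \<le> \<bar>u $ i - v $ i\<bar>"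
      by (cases "v $ i \<le> u $ i") auto
    finally show ?thesis .
  qed
  have "C u - C v = measure N {..u} - measure N {..v}"
    using CN[of u] CN[of v] u v by simp
  also have "\<dots> \<le> measure N (\<Union>i\<in>UNIV. {x. v $ i < x $ i \<and> x $ i \<le> u $ i})"
  proof -
    have "measure N {..u} \<le> measure N ({..v} \<union> (\<Union>i\<in>UNIV. {x. v $ i < x $ i \<and> x $ i \<le> u $ i}))"
      using box slab by (intro finite_measure_mono) (auto simp: less_eq_vec_def not_less)
    also have "\<dots> \<le> measure N {..v} + measure N (\<Union>i\<in>UNIV. {x. v $ i < x $ i \<and> x $ i \<le> u $ i})"
      using box slab by (intro measure_Un_le) auto
    finally show ?thesis by simp
  qed
  also have "\<dots> \<le> (\<Sum>i\<in>UNIV. measure N {x. v $ i < x $ i \<and> x $ i \<le> u $ i})"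
    using slab by (intro finite_measure_subadditive_finite) auto
  also have "\<dots> \<le> (\<Sum>i\<in>UNIV. \<bar>u $ i - v $ i\<bar>)"
    by (intro sum_mono slab_measure)
  finally show ?thesis .
qed

lemma copula_D_Lipschitz:
  fixes C :: "real^'n::finite \<Rightarrow> real"
  assumes C: "is_copula C"
    and u: "\<And>i. 0 \<le> u $ i \<and> u $ i \<le> 1" and v: "\<And>i. 0 \<le> v $ i \<and> v $ i \<le> 1"
  shows "\<bar>copula_D C u - copula_D C v\<bar> \<le> (\<Sum>i\<in>UNIV. \<bar>u $ i - v $ i\<bar>)"
proof -
  have "copula_D C u - copula_D C v \<le> (\<Sum>i\<in>UNIV. \<bar>u $ i - v $ i\<bar>)"
    using is_copula_increment[OF C, of "\<chi> i. 1 - v $ i" "\<chi> i. 1 - u $ i"] u v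
    by (simp add: copula_D_def)
  moreover have "copula_D C v - copula_D C u \<le> (\<Sum>i\<in>UNIV. \<bar>u $ i - v $ i\<bar>)"
    using is_copula_increment[OF C, of "\<chi> i. 1 - u $ i" "\<chi> i. 1 - v $ i"] u v
    by (simp add: copula_D_def abs_minus_commute)
  ultimately show ?thesis by linarith
qed

text \<open>The defining limit of an MRV copula is along rays; the Lipschitz bound extends it to
  arguments that are only asymptotic to a ray.\<close>

lemma MRV_copula_tendsto:
  fixes C :: "real^'n::finite \<Rightarrow> real"
  assumes C: "MRV_copula C"
  obtains l :: "('n \<Rightarrow> real) \<Rightarrow> real" where
    "\<And>(A :: 'b filter) g u v. filterlim g (at_right 0) A \<Longrightarrow>
      (\<And>i x. 0 \<le> u i x \<and> u i x \<le> 1) \<Longrightarrow> (\<And>i. 0 \<le> v i) \<Longrightarrow>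
      (\<And>i. ((\<lambda>x. u i x / g x) \<longlongrightarrow> v i) A) \<Longrightarrow>
      ((\<lambda>x. copula_D C (\<chi> i. u i x) / g x) \<longlongrightarrow> l v) A"
proof -
  have cop: "is_copula C" using C by (simp add: MRV_copula_def)
  obtain l :: "real^'n \<Rightarrow> real" where l: "\<And>v. (\<And>i. 0 \<le> v $ i) \<Longrightarrow>
      ((\<lambda>s. inverse s * copula_D C (s *\<^sub>R v)) \<longlongrightarrow> l v) (at_right 0)"
    using C unfolding MRV_copula_def by blast
  show thesis
  proof (rule that[of "\<lambda>v. l (\<chi> i. v i)"])
    fix A :: "'b filter" and g :: "'b \<Rightarrow> real" and u v
    assume g: "filterlim g (at_right 0) A" and u: "\<And>i x. 0 \<le> u i x \<and> u i x \<le> 1"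
      and v: "\<And>i. 0 \<le> v i" and uv: "\<And>i::'n. ((\<lambda>x. u i x / g x) \<longlongrightarrow> v i) A"
    have g0: "(g \<longlongrightarrow> 0) A" and gpos: "\<forall>\<^sub>F x in A. g x > 0"
      using g by (auto simp: filterlim_at elim: eventually_mono)
    have ray: "((\<lambda>x. inverse (g x) * copula_D C (g x *\<^sub>R (\<chi> i. v i))) \<longlongrightarrow> l (\<chi> i. v i)) A"
      using filterlim_compose[OF l g, of "\<chi> i. v i"] v by simp
    have small: "\<forall>\<^sub>F x in A. \<forall>i. g x * v i < 1"
    proof -
      have "\<forall>\<^sub>F x in A. g x * v i < 1" for i
        using tendsto_mult_right[OF g0, of "v i"] by (intro order_tendstoD(2)[of _ "0 * v i"]) auto
      then show ?thesis by (rule eventually_all_finite)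
    qed
    have bnd: "((\<lambda>x. \<Sum>i\<in>UNIV. \<bar>u i x / g x - v i\<bar>) \<longlongrightarrow> 0) A"
    proof -
      have "((\<lambda>x. \<Sum>i\<in>UNIV. \<bar>u i x / g x - v i\<bar>) \<longlongrightarrow> (\<Sum>i\<in>(UNIV::'n set). \<bar>v i - v i\<bar>)) A"
        by (intro tendsto_intros uv)
      then show ?thesis by simp
    qed
    have "((\<lambda>x. copula_D C (\<chi> i. u i x) / g x - inverse (g x) * copula_D C (g x *\<^sub>R (\<chi> i. v i))) \<longlongrightarrow> 0) A"
    proof (rule Lim_null_comparison[OF _ bnd])
      show "\<forall>\<^sub>F x in A. norm (copula_D C (\<chi> i. u i x) / g x
          - inverse (g x) * copula_D C (g x *\<^sub>R (\<chi> i. v i))) \<le> (\<Sum>i\<in>UNIV. \<bar>u i x / g x - v i\<bar>)"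
        using gpos small
      proof eventually_elim
        case (elim x)
        have "\<bar>copula_D C (\<chi> i. u i x) - copula_D C (g x *\<^sub>R (\<chi> i. v i))\<bar> \<le> (\<Sum>i\<in>UNIV. \<bar>u i x - g x * v i\<bar>)"
          using copula_D_Lipschitz[OF cop, of "\<chi> i. u i x" "g x *\<^sub>R (\<chi> i. v i)"] u v elim
          by (simp add: less_imp_le)
        then have "\<bar>copula_D C (\<chi> i. u i x) - copula_D C (g x *\<^sub>R (\<chi> i. v i))\<bar> / g x
            \<le> (\<Sum>i\<in>UNIV. \<bar>u i x - g x * v i\<bar>) / g x"
          using elim by (intro divide_right_mono) auto
        also have "(\<Sum>i\<in>UNIV. \<bar>u i x - g x * v i\<bar>) / g x = (\<Sum>i\<in>UNIV. \<bar>u i x / g x - v i\<bar>)"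
          unfolding sum_divide_distrib
        proof (rule sum.cong[OF refl])
          fix i
          have "u i x / g x - v i = (u i x - g x * v i) / g x" using elim by (simp add: field_simps)
          then show "\<bar>u i x - g x * v i\<bar> / g x = \<bar>u i x / g x - v i\<bar>" using elim by simp
        qed
        also have "\<bar>copula_D C (\<chi> i. u i x) - copula_D C (g x *\<^sub>R (\<chi> i. v i))\<bar> / g x
            = norm (copula_D C (\<chi> i. u i x) / g x - inverse (g x) * copula_D C (g x *\<^sub>R (\<chi> i. v i)))"
        proof -
          have "copula_D C (\<chi> i. u i x) / g x - inverse (g x) * copula_D C (g x *\<^sub>R (\<chi> i. v i))
              = (copula_D C (\<chi> i. u i x) - copula_D C (g x *\<^sub>R (\<chi> i. v i))) / g x"
            by (simp add: divide_inverse algebra_simps)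
          then show ?thesis using elim by simp
        qed
        finally show ?case .
      qed
    qed
    from tendsto_add[OF this ray]
    show "((\<lambda>x. copula_D C (\<chi> i. u i x) / g x) \<longlongrightarrow> l (\<chi> i. v i)) A" by simp
  qed
qed

lemma (in prob_space) atom_event:
  assumes fin: "finite \<Lambda>" and E: "\<And>k. k \<in> \<Lambda> \<Longrightarrow> E k \<in> events" and T: "T \<subseteq> \<Lambda>"
  shows "{w \<in> space M. {k \<in> \<Lambda>. w \<in> E k} = T} \<in> events"
proof -
  have "{w \<in> space M. {k \<in> \<Lambda>. w \<in> E k} = T} = {w \<in> space M. \<forall>k\<in>\<Lambda>. (w \<in> E k) = (k \<in> T)}"
    using T by blast
  also have "\<dots> \<in> events"
  proof (rule sets.sets_Collect_finite_All[OF _ fin])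
    fix k assume k: "k \<in> \<Lambda>"
    have "{w \<in> space M. (w \<in> E k) = (k \<in> T)} = (if k \<in> T then E k else space M - E k)"
      using sets.sets_into_space[OF E[OF k]] by auto
    then show "{w \<in> space M. (w \<in> E k) = (k \<in> T)} \<in> events"
      using E[OF k] by simp
  qed
  finally show ?thesis .
qed

text \<open>The limit of the probability of an atom of the algebra generated by finitely many events is
  found by induction on the set \<open>T\<close> of events that occur: the probability that some event
  occurs, but none outside \<open>T\<close>, is a difference of probabilities of unions.\<close>

lemma (in prob_space) atoms_tendsto:
  fixes E :: "'k \<Rightarrow> 'b \<Rightarrow> 'a set"
  assumes fin: "finite \<Lambda>" and E: "\<And>k x. k \<in> \<Lambda> \<Longrightarrow> E k x \<in> events"
    and unions: "\<And>S. S \<subseteq> \<Lambda> \<Longrightarrow> \<exists>L. ((\<lambda>x. prob (\<Union>k\<in>S. E k x) / g x) \<longlongrightarrow> L) A"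
    and T: "T \<subseteq> \<Lambda>" "T \<noteq> {}"
  shows "\<exists>L. ((\<lambda>x. prob {w \<in> space M. {k \<in> \<Lambda>. w \<in> E k x} = T} / g x) \<longlongrightarrow> L) A"
  using finite_subset[OF T(1) fin] T
proof (induction T rule: finite_psubset_induct)
  case (psubset T)
  let ?a = "\<lambda>T x. {w \<in> space M. {k \<in> \<Lambda>. w \<in> E k x} = T}"
  have a_events: "?a S x \<in> events" if "S \<subseteq> \<Lambda>" for S x
    by (rule atom_event[OF fin E that])
  have decomp: "prob (?a T x) = prob (\<Union>k\<in>\<Lambda>. E k x) - prob (\<Union>k\<in>\<Lambda> - T. E k x)
      - (\<Sum>S\<in>{S. S \<subset> T \<and> S \<noteq> {}}. prob (?a S x))" for x
  proof -
    have fT: "finite {S. S \<subseteq> T \<and> S \<noteq> {}}"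
      by (rule finite_subset[of _ "Pow T"]) (use psubset.hyps in auto)
    \<comment> \<open>Some event occurs but none outside \<open>T\<close>: the events that occur form a nonempty subset of \<open>T\<close>.\<close>
    have "(\<Union>k\<in>\<Lambda>. E k x) - (\<Union>k\<in>\<Lambda> - T. E k x) = (\<Union>S\<in>{S. S \<subseteq> T \<and> S \<noteq> {}}. ?a S x)"
      (is "?L = ?R")
    proof
      show "?L \<subseteq> ?R" using sets.sets_into_space[OF E] by fastforce
      show "?R \<subseteq> ?L" using psubset.prems by blast
    qed
    then have "prob (\<Union>S\<in>{S. S \<subseteq> T \<and> S \<noteq> {}}. ?a S x) = prob (\<Union>k\<in>\<Lambda>. E k x) - prob (\<Union>k\<in>\<Lambda> - T. E k x)"
      using E fin by (subst finite_measure_Diff[symmetric]) (auto intro!: sets.finite_UN)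
    moreover have "prob (\<Union>S\<in>{S. S \<subseteq> T \<and> S \<noteq> {}}. ?a S x) = (\<Sum>S\<in>{S. S \<subseteq> T \<and> S \<noteq> {}}. prob (?a S x))"
      using a_events psubset.prems
      by (intro finite_measure_finite_Union fT) (auto simp: disjoint_family_on_def)
    moreover have "{S. S \<subseteq> T \<and> S \<noteq> {}} = insert T {S. S \<subset> T \<and> S \<noteq> {}}"
      using psubset.prems by auto
    moreover have "finite {S. S \<subset> T \<and> S \<noteq> {}}"
      using fT by (rule rev_finite_subset) auto
    ultimately show ?thesis by simp
  qed
  obtain L1 L2 where "((\<lambda>x. prob (\<Union>k\<in>\<Lambda>. E k x) / g x) \<longlongrightarrow> L1) A"
    "((\<lambda>x. prob (\<Union>k\<in>\<Lambda> - T. E k x) / g x) \<longlongrightarrow> L2) A"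
    using unions[of \<Lambda>] unions[of "\<Lambda> - T"] by auto
  moreover obtain l where "\<And>S. S \<in> {S. S \<subset> T \<and> S \<noteq> {}} \<Longrightarrow> ((\<lambda>x. prob (?a S x) / g x) \<longlongrightarrow> l S) A"
  proof -
    have "\<forall>S\<in>{S. S \<subset> T \<and> S \<noteq> {}}. \<exists>L. ((\<lambda>x. prob (?a S x) / g x) \<longlongrightarrow> L) A"
      using psubset.IH psubset.prems by auto
    from bchoice[OF this] show thesis using that by blast
  qed
  ultimately have "((\<lambda>x. prob (\<Union>k\<in>\<Lambda>. E k x) / g x - prob (\<Union>k\<in>\<Lambda> - T. E k x) / g x
      - (\<Sum>S\<in>{S. S \<subset> T \<and> S \<noteq> {}}. prob (?a S x) / g x)) \<longlongrightarrow> L1 - L2 - (\<Sum>S\<in>{S. S \<subset> T \<and> S \<noteq> {}}. l S)) A"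
    by (intro tendsto_intros)
  then show ?case
    unfolding decomp diff_divide_distrib sum_divide_distrib by blast
qed

lemma (in prob_space) Boolean_combination_tendsto:
  fixes E :: "'k \<Rightarrow> 'b \<Rightarrow> 'a set"
  assumes fin: "finite \<Lambda>" and E: "\<And>k x. k \<in> \<Lambda> \<Longrightarrow> E k x \<in> events"
    and unions: "\<And>S. S \<subseteq> \<Lambda> \<Longrightarrow> \<exists>L. ((\<lambda>x. prob (\<Union>k\<in>S. E k x) / g x) \<longlongrightarrow> L) A"
    and \<phi>: "\<not> \<phi> {}"
  shows "\<exists>L. ((\<lambda>x. prob {w \<in> space M. \<phi> {k \<in> \<Lambda>. w \<in> E k x}} / g x) \<longlongrightarrow> L) A"
    and "{w \<in> space M. \<phi> {k \<in> \<Lambda>. w \<in> E k x}} \<in> events"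
proof -
  let ?a = "\<lambda>T x. {w \<in> space M. {k \<in> \<Lambda>. w \<in> E k x} = T}"
  let ?\<S> = "{T. T \<subseteq> \<Lambda> \<and> \<phi> T}"
  have a_events: "?a S x \<in> events" if "S \<subseteq> \<Lambda>" for S x
    by (rule atom_event[OF fin E that])
  have fS: "finite ?\<S>" by (rule finite_subset[of _ "Pow \<Lambda>"]) (use fin in auto)
  have eq: "{w \<in> space M. \<phi> {k \<in> \<Lambda>. w \<in> E k x}} = (\<Union>T\<in>?\<S>. ?a T x)" for x by auto
  show "{w \<in> space M. \<phi> {k \<in> \<Lambda>. w \<in> E k x}} \<in> events"
    unfolding eq using a_events fS by (intro sets.finite_UN) auto
  have "prob {w \<in> space M. \<phi> {k \<in> \<Lambda>. w \<in> E k x}} = (\<Sum>T\<in>?\<S>. prob (?a T x))" for x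
    unfolding eq using a_events
    by (intro finite_measure_finite_Union fS) (auto simp: disjoint_family_on_def)
  moreover
  have ex: "\<forall>T\<in>?\<S>. \<exists>L. ((\<lambda>x. prob (?a T x) / g x) \<longlongrightarrow> L) A"
  proof
    fix T assume "T \<in> ?\<S>"
    then show "\<exists>L. ((\<lambda>x. prob (?a T x) / g x) \<longlongrightarrow> L) A"
      using \<phi> by (intro atoms_tendsto fin E unions) auto
  qed
  from bchoice[OF ex] obtain l where "\<forall>T\<in>?\<S>. ((\<lambda>x. prob (?a T x) / g x) \<longlongrightarrow> l T) A" ..
  then have "((\<lambda>x. \<Sum>T\<in>?\<S>. prob (?a T x) / g x) \<longlongrightarrow> (\<Sum>T\<in>?\<S>. l T)) A"
    by (intro tendsto_sum) blast
  ultimately show "\<exists>L. ((\<lambda>x. prob {w \<in> space M. \<phi> {k \<in> \<Lambda>. w \<in> E k x}} / g x) \<longlongrightarrow> L) A"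
    by (auto simp: sum_divide_distrib)
qed

section \<open>The lower tails of the p-values\<close>

text \<open>P-values without atoms, under arbitrary dependence.\<close>

locale continuous_pvalues = prob_space M for M :: "'a measure" +
  fixes P :: "'n::finite \<Rightarrow> 'a \<Rightarrow> real"
  assumes P_measurable[measurable]: "\<And>i. P i \<in> borel_measurable M"
    and P_range: "\<And>i w. w \<in> space M \<Longrightarrow> P i w \<in> {0..1}"
    and P_continuous: "\<And>i. continuous_on UNIV (law_cdf M (P i))"
begin

text \<open>The lower tail of the \<open>i\<close>-th p-value. As there are no atoms it does not matter whether the
  inequality is strict.\<close>

definition G :: "'n \<Rightarrow> real \<Rightarrow> real" where
  "G i t = prob {w \<in> space M. P i w < t}"

lemma AE_neq: "AE w in M. P i w \<noteq> a"
proof -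
  interpret D: real_distribution "distr M borel (P i)"
    by (rule real_distribution_distr) simp
  have "isCont (cdf (distr M borel (P i))) a"
    using P_continuous[of i] by (simp add: continuous_on_eq_continuous_at law_cdf_def)
  then have "measure (distr M borel (P i)) {a} = 0"
    by (simp add: D.isCont_cdf)
  then have "prob {w \<in> space M. P i w = a} = 0"
    by (simp add: measure_distr vimage_def Int_def conj_commute)
  then show ?thesis
    by (subst AE_iff_measurable[OF _ refl]) (auto simp: emeasure_eq_measure)
qed

lemma AE_interior: "AE w in M. \<forall>i. 0 < P i w \<and> P i w < 1"
proof -
  have "AE w in M. \<forall>i. P i w \<noteq> 0 \<and> P i w \<noteq> 1"
    by (intro AE_all_countable[THEN iffD2] allI AE_conjI AE_neq) 
  then show ?thesis
    using AE_space
  proof eventually_elim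
    case (elim w)
    then show ?case using P_range[of w] by (fastforce simp: less_le)
  qed
qed

lemma G_eq_le: "G i t = prob {w \<in> space M. P i w \<le> t}"
  unfolding G_def
proof (rule finite_measure_eq_AE)
  show "AE w in M. w \<in> {w \<in> space M. P i w < t} \<longleftrightarrow> w \<in> {w \<in> space M. P i w \<le> t}"
    using AE_neq[of i t] by eventually_elim auto
qed measurable

lemma G_eq_law_cdf: "G i t = law_cdf M (P i) t"
  unfolding G_eq_le law_cdf_def cdf_def
  by (subst measure_distr) (auto intro!: arg_cong[where f = prob])

lemma mono_G: "mono (G i)"
  unfolding G_def by (intro monoI finite_measure_mono) auto

lemma G_bounds: "0 \<le> G i t \<and> G i t \<le> 1"
  by (simp add: G_def)

lemma G_0: "G i 0 = 0"
proof -
  have "{w \<in> space M. P i w < 0} = {}" using P_range[of _ i] by force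
  then show ?thesis unfolding G_def by (simp only: measure_empty)
qed

lemma G_tendsto_0: "(G i \<longlongrightarrow> 0) (at_right 0)"
proof -
  have "isCont (G i) 0"
    using P_continuous[of i] by (simp add: continuous_on_eq_continuous_at G_eq_law_cdf[abs_def])
  then have "(G i \<longlongrightarrow> G i 0) (at 0)" by (simp add: isCont_def)
  then show ?thesis by (simp add: G_0 filterlim_at_split)
qed

lemma law_cdf_complement: "law_cdf M (\<lambda>w. 1 - P i w) x = 1 - G i (1 - x)"
proof -
  have "law_cdf M (\<lambda>w. 1 - P i w) x = prob {w \<in> space M. 1 - P i w \<le> x}"
    unfolding law_cdf_def cdf_def
    by (subst measure_distr) (auto intro!: arg_cong[where f = prob])
  also have "\<dots> = prob (space M - {w \<in> space M. P i w < 1 - x})"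
    by (rule arg_cong[where f = prob]) auto
  also have "\<dots> = 1 - G i (1 - x)"
    unfolding G_def by (rule prob_compl) measurable
  finally show ?thesis .
qed

text \<open>The probability that some p-value is below its threshold.\<close>

definition U :: "('n \<Rightarrow> real) \<Rightarrow> real" where
  "U t = prob {w \<in> space M. \<exists>i. P i w < t i}"

lemma U_eq_copula_D:
  assumes "copula_of M (\<lambda>i w. 1 - P i w) C"
  shows "U t = copula_D C (\<chi> i. G i (t i))"
proof -
  have "prob {w \<in> space M. \<forall>i. 1 - P i w \<le> (\<chi> i. 1 - t i) $ i}
      = C (\<chi> i. law_cdf M (\<lambda>w. 1 - P i w) ((\<chi> i. 1 - t i) $ i))"
    using assms unfolding copula_of_def by blast
  then have "prob {w \<in> space M. \<forall>i. 1 - P i w \<le> 1 - t i} = C (\<chi> i. 1 - G i (t i))"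
    by (simp add: law_cdf_complement)
  moreover have "{w \<in> space M. \<exists>i. P i w < t i} = space M - {w \<in> space M. \<forall>i. 1 - P i w \<le> 1 - t i}"
    by (auto simp flip: not_less)
  ultimately show ?thesis
    unfolding U_def by (simp add: prob_compl copula_D_def)
qed

lemma G_le_U: "G i (t i) \<le> U t"
  unfolding G_def U_def by (intro finite_measure_mono) auto

text \<open>Atoms at 0 and 1, where \<^const>\<open>quantile\<close> does not have its usual meaning, are absent, so the
  survival function of the transformed p-value is \<open>G i \<circ> (1 - F0)\<close>.\<close>

lemma tail_index:
  assumes F0: "F0 \<in> reg_varying 1"
    and \<beta>: "law_cdf M (\<lambda>w. quantile F0 (1 - P i w)) \<in> reg_varying \<beta>"
  shows "t > 0 \<Longrightarrow> G i t > 0"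
    and "s > 0 \<Longrightarrow> ((\<lambda>t. G i (t * s) / G i t) \<longlongrightarrow> s powr \<beta>) (at_right 0)"
proof -
  let ?X = "\<lambda>w. quantile F0 (1 - P i w)"
  have F0c: "is_cdf F0" using F0 by (simp add: reg_varying_def)
  have X: "?X \<in> borel_measurable M"
    using P_range by (intro measurable_quantile[OF F0c]) auto
  have "1 - law_cdf M ?X x = G i (1 - F0 x)" for x
  proof -
    have "law_cdf M ?X x = prob {w \<in> space M. ?X w \<le> x}"
      unfolding law_cdf_def cdf_def using X
      by (subst measure_distr) (auto intro!: arg_cong[where f = prob])
    then have "1 - law_cdf M ?X x = prob (space M - {w \<in> space M. ?X w \<le> x})"
      using X by (subst prob_compl) auto
    also have "\<dots> = G i (1 - F0 x)"
      unfolding G_def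
    proof (rule finite_measure_eq_AE)
      show "AE w in M. w \<in> space M - {w \<in> space M. ?X w \<le> x} \<longleftrightarrow> w \<in> {w \<in> space M. P i w < 1 - F0 x}"
        using AE_interior
      proof eventually_elim
        case (elim w)
        then show ?case
          using less_quantile_iff[OF F0c, of "1 - P i w" x] by (auto simp: not_le)
      qed
    qed (use X in measurable)
    finally show ?thesis .
  qed
  from tail_index_of_quantile_tail[OF F0 \<beta> this mono_G]
  show "t > 0 \<Longrightarrow> G i t > 0"
    and "s > 0 \<Longrightarrow> ((\<lambda>t. G i (t * s) / G i t) \<longlongrightarrow> s powr \<beta>) (at_right 0)" by auto
qed

text \<open>The relation \<open>\<succ>\<close> is a strict partial order, so on the finite index set every dominated
  p-value is dominated by a dominating one.\<close>

lemma relative_tail_tendsto: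
  assumes comparable: "\<And>i j. i \<in> dominating M P \<Longrightarrow> j \<in> dominating M P \<Longrightarrow> i \<noteq> j \<Longrightarrow>
      \<exists>L>0. ((\<lambda>t. G i t / G j t) \<longlongrightarrow> L) (at_right 0)"
    and i0: "i0 \<in> dominating M P" and pos: "\<And>t. t > 0 \<Longrightarrow> G i0 t > 0"
  shows "\<exists>c\<ge>0. ((\<lambda>t. G i t / G i0 t) \<longlongrightarrow> c) (at_right 0)"
proof -
  have small: "\<forall>\<^sub>F t in at_right 0. (t::real) > 0"
    by (simp add: eventually_at_right_less)
  have self: "((\<lambda>t. G j t / G j t) \<longlongrightarrow> 1) (at_right 0)" if "\<And>t. t > 0 \<Longrightarrow> G j t > 0" for j
    by (rule tendsto_eventually) (use small in \<open>eventually_elim, force dest: that\<close>)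
  have dom: "\<exists>c\<ge>0. ((\<lambda>t. G j t / G i0 t) \<longlongrightarrow> c) (at_right 0)" if "j \<in> dominating M P" for j
  proof (cases "j = i0")
    case True
    then show ?thesis using self[of i0] pos by (intro exI[of _ 1]) auto
  next
    case False
    then show ?thesis using comparable[OF that i0] by (auto intro: less_imp_le)
  qed
  show ?thesis
  proof (cases "i \<in> dominating M P")
    case True
    then show ?thesis by (rule dom)
  next
    case False
    define R where "R j k \<longleftrightarrow> succ_pval M (P j) (P k)" for j k
    have R: "R j k \<longleftrightarrow> (\<forall>t>0. G k t > 0) \<and> ((\<lambda>t. G j t / G k t) \<longlongrightarrow> 0) (at_right 0)" for j k
      by (simp add: R_def succ_pval_def G_def)
    have irrefl: "\<not> R j j" for j
    proof
      assume "R j j"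
      then have pos_j: "\<And>t. t > 0 \<Longrightarrow> G j t > 0"
        and lim: "((\<lambda>t. G j t / G j t) \<longlongrightarrow> 0) (at_right 0)"
        unfolding R by auto
      show False using tendsto_unique[OF _ lim self[OF pos_j]] by simp
    qed
    have trans: "R j l" if "R j k" "R k l" for j k l
    proof -
      have "((\<lambda>t. (G j t / G k t) * (G k t / G l t)) \<longlongrightarrow> 0 * 0) (at_right 0)"
        using that by (intro tendsto_mult) (auto simp: R)
      moreover have "\<forall>\<^sub>F t in at_right 0. (G j t / G k t) * (G k t / G l t) = G j t / G l t"
        using small
      proof eventually_elim
        case (elim t)
        then have "G k t > 0" using that by (simp add: R)
        then show ?case by simp
      qed
      ultimately have "((\<lambda>t. G j t / G l t) \<longlongrightarrow> 0 * 0) (at_right 0)"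
        by (rule Lim_transform_eventually)
      then show ?thesis using that by (simp add: R)
    qed
    let ?A = "{j. R i j}"
    have "?A \<noteq> {}" using False by (auto simp: dominating_def R_def)
    moreover have "asymp_on ?A R" using irrefl trans by (auto intro!: asymp_onI)
    moreover have "transp_on ?A R" using trans by (auto intro!: transp_onI)
    ultimately obtain j where j: "R i j" "\<And>k. R i k \<Longrightarrow> k \<noteq> j \<Longrightarrow> \<not> R j k"
      using Finite_Set.bex_max_element[of ?A R] by auto
    have "j \<in> dominating M P"
      using j trans irrefl unfolding dominating_def R_def[symmetric] by blast
    then obtain c where c: "((\<lambda>t. G j t / G i0 t) \<longlongrightarrow> c) (at_right 0)" using dom by blast
    have "((\<lambda>t. (G i t / G j t) * (G j t / G i0 t)) \<longlongrightarrow> 0 * c) (at_right 0)"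
      using j(1) by (intro tendsto_mult c) (simp add: R)
    moreover have "\<forall>\<^sub>F t in at_right 0. (G i t / G j t) * (G j t / G i0 t) = G i t / G i0 t"
      using small
    proof eventually_elim
      case (elim t)
      then have "G j t > 0" using j(1) by (simp add: R)
      then show ?case by simp
    qed
    ultimately have "((\<lambda>t. G i t / G i0 t) \<longlongrightarrow> 0 * c) (at_right 0)"
      by (rule Lim_transform_eventually)
    then show ?thesis by (intro exI[of _ 0]) simp
  qed
qed

end

section \<open>Sums of regularly varying transforms\<close>

text \<open>Counting the points \<open>j / m\<close> with \<open>1 \<le> j \<le> m\<close> below \<open>Y\<close> recovers the truncation of \<open>Y\<close> to
  \<open>[0, 1]\<close> up to \<open>1 / m\<close>.\<close>

lemma grid_count:
  fixes Y :: real
  assumes m: "m \<ge> 1"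
  defines "N \<equiv> {k \<in> {1..m}. real k / real m < Y}"
  shows "real (card N) / real m \<le> max 0 Y" and "min Y 1 \<le> real (card N) / real m + 1 / real m"
proof -
  have fin: "finite N" by (simp add: N_def)
  have "N \<subseteq> {1..nat \<lfloor>real m * max 0 Y\<rfloor>}"
  proof
    fix k assume k: "k \<in> N"
    then have "real k / real m < Y" by (simp add: N_def)
    moreover from this have "0 \<le> Y" by (rule order_trans[OF _ less_imp_le, rotated]) simp
    ultimately have "real k \<le> real m * max 0 Y" using m by (simp add: field_simps)
    then show "k \<in> {1..nat \<lfloor>real m * max 0 Y\<rfloor>}" using k by (simp add: N_def le_nat_floor)
  qed
  then have "card N \<le> nat \<lfloor>real m * max 0 Y\<rfloor>"
    using card_mono[of "{1..nat \<lfloor>real m * max 0 Y\<rfloor>}" N] by simp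
  then have "real (card N) \<le> real m * max 0 Y"
    by (meson of_nat_floor of_nat_le_iff order_trans max.cobounded1 mult_nonneg_nonneg of_nat_0_le_iff)
  then show "real (card N) / real m \<le> max 0 Y" using m by (simp add: field_simps)
  define r where "r = min m (nat \<lceil>real m * Y\<rceil> - 1)"
  have "{1..r} \<subseteq> N"
  proof
    fix k assume k: "k \<in> {1..r}"
    then have "k < nat \<lceil>real m * Y\<rceil>" by (auto simp: r_def)
    then have "real k < real m * Y" by linarith
    then show "k \<in> N" using k m by (auto simp: N_def r_def field_simps)
  qed
  then have "r \<le> card N" using card_mono[OF fin, of "{1..r}"] by simp
  moreover have "real m * min Y 1 \<le> real r + 1"
  proof (cases "r = m")
    case True
    have "real m * min Y 1 \<le> real m * 1" by (intro mult_left_mono) auto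
    then show ?thesis using True by simp
  next
    case False
    then have "r = nat \<lceil>real m * Y\<rceil> - 1" by (auto simp: r_def)
    then have "real m * Y \<le> real r + 1" by linarith
    moreover have "real m * min Y 1 \<le> real m * Y" by (intro mult_left_mono) auto
    ultimately show ?thesis by linarith
  qed
  ultimately have "real m * min Y 1 \<le> real (card N) + 1" by linarith
  then show "min Y 1 \<le> real (card N) / real m + 1 / real m"
    using m by (simp add: field_simps)
qed

text \<open>The situation in which both tests are compared. The p-value \<open>i0\<close> serves as a reference: its lower
  tail is regularly varying at 0 with index \<open>\<beta>\<close>, and every lower tail is asymptotically a multiple
  \<open>c i\<close> of it, where \<open>c i = 0\<close> if \<open>i0\<close> is the stronger signal. All that is kept of the copula is the function
  \<open>l\<close>, which turns the relative sizes \<open>v i\<close> of marginal tail probabilities into the relative size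
  of the probability of the union.\<close>

locale weighted_tails = continuous_pvalues M P
  for M :: "'a measure" and P :: "'n::finite \<Rightarrow> 'a \<Rightarrow> real" +
  fixes \<omega> :: "'n \<Rightarrow> real" and i0 :: 'n and \<beta> :: real and c :: "'n \<Rightarrow> real"
    and l :: "('n \<Rightarrow> real) \<Rightarrow> real"
  assumes \<omega>_pos: "\<And>i. \<omega> i > 0"
    and G_pos: "\<And>t. t > 0 \<Longrightarrow> G i0 t > 0"
    and G_rv: "\<And>s. s > 0 \<Longrightarrow> ((\<lambda>t. G i0 (t * s) / G i0 t) \<longlongrightarrow> s powr \<beta>) (at_right 0)"
    and c_nonneg: "\<And>i. c i \<ge> 0"
    and G_rel: "\<And>i. ((\<lambda>t. G i t / G i0 t) \<longlongrightarrow> c i) (at_right 0)"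
    and U_tendsto: "\<And>(A :: real filter) g t v. filterlim g (at_right 0) A \<Longrightarrow> (\<And>i. 0 \<le> v i) \<Longrightarrow>
      (\<And>i. ((\<lambda>x. G i (t i x) / g x) \<longlongrightarrow> v i) A) \<Longrightarrow> ((\<lambda>x. U (\<lambda>i. t i x) / g x) \<longlongrightarrow> l v) A"
begin

lemma G_compose_at_right:
  assumes T: "filterlim T (at_right 0) A"
  shows "filterlim (\<lambda>x. G i0 (T x)) (at_right 0) A"
  unfolding filterlim_at
proof
  show "((\<lambda>x. G i0 (T x)) \<longlongrightarrow> 0) A" using filterlim_compose[OF G_tendsto_0 T] .
  have "\<forall>\<^sub>F x in A. T x > 0" using T by (auto simp: filterlim_at elim: eventually_mono)
  then show "\<forall>\<^sub>F x in A. G i0 (T x) \<in> {0<..} \<and> G i0 (T x) \<noteq> 0"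
    by eventually_elim (use G_pos in fastforce)
qed

lemma G_rv_compose:
  assumes "filterlim T (at_right 0) A" "(r \<longlongrightarrow> s) A" "s > 0"
  shows "((\<lambda>x. G i0 (T x * r x) / G i0 (T x)) \<longlongrightarrow> s powr \<beta>) A"
  by (rule regular_variation_compose[OF mono_G G_pos G_rv assms])

lemma G_rel_compose:
  assumes T: "filterlim T (at_right 0) A" and r: "(r \<longlongrightarrow> s) A" and s: "s > 0"
  shows "((\<lambda>x. G i (T x * r x) / G i0 (T x)) \<longlongrightarrow> c i * s powr \<beta>) A"
proof -
  have T0: "(T \<longlongrightarrow> 0) A" and Tpos: "\<forall>\<^sub>F x in A. T x > 0"
    using T by (auto simp: filterlim_at elim: eventually_mono)
  have rpos: "\<forall>\<^sub>F x in A. r x > 0" using order_tendstoD(1)[OF r s] .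
  have Tr: "filterlim (\<lambda>x. T x * r x) (at_right 0) A"
    unfolding filterlim_at
  proof
    show "((\<lambda>x. T x * r x) \<longlongrightarrow> 0) A" using tendsto_mult[OF T0 r] by simp
    show "\<forall>\<^sub>F x in A. T x * r x \<in> {0<..} \<and> T x * r x \<noteq> 0"
      using Tpos rpos by eventually_elim simp
  qed
  have "((\<lambda>x. G i (T x * r x) / G i0 (T x * r x) * (G i0 (T x * r x) / G i0 (T x))) \<longlongrightarrow> c i * s powr \<beta>) A"
    by (intro tendsto_mult filterlim_compose[OF G_rel Tr] G_rv_compose assms)
  moreover have "\<forall>\<^sub>F x in A. G i (T x * r x) / G i0 (T x * r x) * (G i0 (T x * r x) / G i0 (T x))
      = G i (T x * r x) / G i0 (T x)"
    using Tpos rpos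
  proof eventually_elim
    case (elim x)
    then have "G i0 (T x * r x) > 0" by (intro G_pos) simp
    then show ?case by simp
  qed
  ultimately show ?thesis by (rule Lim_transform_eventually)
qed

text \<open>The limiting size of the union \<open>{\<exists>i. P i < \<omega> i * t}\<close> relative to \<open>G i0 t\<close>.\<close>

definition b :: real where "b = l (\<lambda>i. c i * \<omega> i powr \<beta>)"

lemma U_weighted_tendsto:
  assumes T: "filterlim T (at_right 0) (A :: real filter)"
  shows "((\<lambda>x. U (\<lambda>i. \<omega> i * T x) / G i0 (T x)) \<longlongrightarrow> b) A"
  unfolding b_def
proof (rule U_tendsto[OF G_compose_at_right[OF T]])
  show "((\<lambda>x. G i (\<omega> i * T x) / G i0 (T x)) \<longlongrightarrow> c i * \<omega> i powr \<beta>) A" for i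
    using G_rel_compose[OF T tendsto_const \<omega>_pos[of i], of i] by (simp add: mult.commute)
qed (simp add: c_nonneg)

lemma b_pos: "b > 0"
proof -
  have id: "filterlim (\<lambda>t. t) (at_right 0) (at_right (0::real))" by (rule filterlim_ident)
  have "((\<lambda>t. G i0 (t * \<omega> i0) / G i0 t) \<longlongrightarrow> \<omega> i0 powr \<beta>) (at_right 0)"
    using G_rv[OF \<omega>_pos] .
  moreover have "\<forall>\<^sub>F t in at_right 0. G i0 (t * \<omega> i0) / G i0 t \<le> U (\<lambda>i. \<omega> i * t) / G i0 t"
  proof (rule always_eventually, rule allI)
    fix t show "G i0 (t * \<omega> i0) / G i0 t \<le> U (\<lambda>i. \<omega> i * t) / G i0 t"
      using G_le_U[of i0 "\<lambda>i. \<omega> i * t"] G_bounds[of i0 t]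
      by (intro divide_right_mono) (auto simp: mult.commute)
  qed
  ultimately have "\<omega> i0 powr \<beta> \<le> b"
    using tendsto_le[OF _ U_weighted_tendsto[OF id]] by simp
  then show ?thesis using \<omega>_pos[of i0] by (smt (verit) powr_gt_zero)
qed

text \<open>A transformation function with tail index \<open>\<gamma>\<close>, supported on \<open>[k, \<infinity>)\<close>.\<close>

context
  fixes F :: "real \<Rightarrow> real" and \<gamma> k :: real
  assumes F_rv: "F \<in> reg_varying \<gamma>" and F_support: "cdf_support F = {k..}"
begin

text \<open>The rate at which tail probabilities at level \<open>x\<close> decay after transforming the p-values by \<open>F\<close>;
  it is regularly varying at infinity with index \<open>- \<gamma> * \<beta>\<close>.\<close>

definition g :: "real \<Rightarrow> real" where "g x = G i0 (1 - F x)"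

text \<open>The transformed p-values, whose average is the combination statistic.\<close>

definition X :: "'n \<Rightarrow> 'a \<Rightarrow> real" where
  "X i w = quantile F (max 0 (1 - P i w / \<omega> i))"

lemma F_cdf: "is_cdf F" using F_rv by (simp add: reg_varying_def)

lemma g_pos: "g x > 0"
  unfolding g_def using reg_varying_less_1[OF F_rv, of x] by (intro G_pos) simp

lemma tail_at_right: "filterlim (\<lambda>x. 1 - F x) (at_right 0) at_top"
  by (rule reg_varying_tail_at_right_0[OF F_rv])

lemma tail_ratio: "y > 0 \<Longrightarrow> ((\<lambda>x. (1 - F (x * y)) / (1 - F x)) \<longlongrightarrow> y powr - \<gamma>) at_top"
  using F_rv by (simp add: reg_varying_def)

lemma g_scale:
  assumes "y > 0"
  shows "((\<lambda>x. g (x * y) / g x) \<longlongrightarrow> y powr - (\<gamma> * \<beta>)) at_top"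
proof -
  have "((\<lambda>x. G i0 ((1 - F x) * ((1 - F (x * y)) / (1 - F x))) / G i0 (1 - F x)) \<longlongrightarrow> (y powr - \<gamma>) powr \<beta>) at_top"
    using assms by (intro G_rv_compose tail_at_right tail_ratio) auto
  moreover have "(1 - F x) * ((1 - F (x * y)) / (1 - F x)) = 1 - F (x * y)" for x
    using reg_varying_less_1[OF F_rv, of x] by simp
  ultimately show ?thesis by (simp add: g_def powr_powr)
qed

lemma G_tail_tendsto:
  assumes "y > 0"
  shows "((\<lambda>x. G i (\<omega> i * (1 - F (x * y))) / g x) \<longlongrightarrow> c i * (\<omega> i * y powr - \<gamma>) powr \<beta>) at_top"
proof -
  have "((\<lambda>x. G i ((1 - F x) * (\<omega> i * ((1 - F (x * y)) / (1 - F x)))) / G i0 (1 - F x))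
      \<longlongrightarrow> c i * (\<omega> i * y powr - \<gamma>) powr \<beta>) at_top"
    using assms \<omega>_pos[of i] by (intro G_rel_compose tail_at_right tendsto_mult tendsto_const tail_ratio) auto
  moreover have "(1 - F x) * (\<omega> i * ((1 - F (x * y)) / (1 - F x))) = \<omega> i * (1 - F (x * y))" for x
    using reg_varying_less_1[OF F_rv, of x] by simp
  ultimately show ?thesis by (simp add: g_def)
qed

text \<open>The event \<open>X i > x * (j / m)\<close> (up to a null set, for large \<open>x\<close>), written in terms of the p-value.\<close>

definition E :: "nat \<Rightarrow> 'n \<times> nat \<Rightarrow> real \<Rightarrow> 'a set" where
  "E m = (\<lambda>(i, j) x. {w \<in> space M. P i w < \<omega> i * (1 - F (x * (real j / real m)))})"

lemma E_events: "E m p x \<in> events"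
  by (cases p) (simp add: E_def)

text \<open>Of the events for one and the same \<open>i\<close> the one with least threshold contains the others, so a union
  of grid events is of the form \<open>{\<exists>i. P i < t i}\<close>; \<open>t i = 0\<close> makes the \<open>i\<close>-th event empty.\<close>

lemma union_tendsto:
  assumes m: "m \<ge> 1" and S: "S \<subseteq> UNIV \<times> {1..m}"
  shows "\<exists>L. ((\<lambda>x. prob (\<Union>p\<in>S. E m p x) / g x) \<longlongrightarrow> L) at_top"
proof -
  define J where "J i = {j. (i, j) \<in> S}" for i
  \<comment> \<open>\<open>a i\<close> is meaningful only when \<open>J i\<close> is nonempty.\<close>
  define a where "a i = (LEAST j. j \<in> J i)" for i
  define t where "t i x = (if J i = {} then 0 else \<omega> i * (1 - F (x * (real (a i) / real m))))" for i x
  define v where "v i = (if J i = {} then 0 else c i * (\<omega> i * (real (a i) / real m) powr - \<gamma>) powr \<beta>)" for i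
  have a_in: "a i \<in> J i" if "J i \<noteq> {}" for i
    unfolding a_def using that by (meson LeastI ex_in_conv)
  have a_pos: "a i \<ge> 1" if "J i \<noteq> {}" for i
    using a_in[OF that] S by (auto simp: J_def)
  have "((\<lambda>x. U (\<lambda>i. t i x) / g x) \<longlongrightarrow> l v) at_top"
    unfolding g_def
  proof (rule U_tendsto[OF G_compose_at_right[OF tail_at_right]])
    show "0 \<le> v i" for i by (simp add: v_def c_nonneg)
    show "((\<lambda>x. G i (t i x) / G i0 (1 - F x)) \<longlongrightarrow> v i) at_top" for i
    proof (cases "J i = {}")
      case True
      then show ?thesis by (simp add: t_def v_def G_0)
    next
      case False
      then show ?thesis
        using G_tail_tendsto[of "real (a i) / real m" i] a_pos[OF False] m by (simp add: t_def v_def g_def)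
    qed
  qed
  moreover have "\<forall>\<^sub>F x in at_top. U (\<lambda>i. t i x) / g x = prob (\<Union>p\<in>S. E m p x) / g x"
    using eventually_gt_at_top[of 0]
  proof eventually_elim
    case (elim x)
    have "{w \<in> space M. \<exists>i. P i w < t i x} = (\<Union>p\<in>S. E m p x)"
    proof (intro subset_antisym subsetI)
      fix w assume "w \<in> {w \<in> space M. \<exists>i. P i w < t i x}"
      then obtain i where i: "w \<in> space M" "P i w < t i x" by blast
      then have ne: "J i \<noteq> {}" using P_range[of w i] by (auto simp: t_def)
      then have "t i x = \<omega> i * (1 - F (x * (real (a i) / real m)))" by (simp only: t_def if_False)
      then have "(i, a i) \<in> S" "w \<in> E m (i, a i) x"
        using a_in[OF ne] i by (simp_all only: J_def E_def mem_Collect_eq prod.case)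
      then show "w \<in> (\<Union>p\<in>S. E m p x)" by blast
    next
      fix w assume "w \<in> (\<Union>p\<in>S. E m p x)"
      then obtain i j where ij: "(i, j) \<in> S" "w \<in> E m (i, j) x" by auto
      then have ne: "j \<in> J i" by (simp add: J_def)
      then have "a i \<le> j" unfolding a_def by (rule Least_le)
      then have "x * (real (a i) / real m) \<le> x * (real j / real m)"
        using elim m by (intro mult_left_mono divide_right_mono) auto
      then have "\<omega> i * (1 - F (x * (real j / real m))) \<le> t i x"
        using ne is_cdf_mono[OF F_cdf] \<omega>_pos[of i] by (auto simp: t_def intro!: mult_left_mono)
      then show "w \<in> {w \<in> space M. \<exists>i. P i w < t i x}"
        using ij by (auto simp: E_def intro!: exI[of _ i])
    qed
    then show ?case by (simp add: U_def)
  qed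
  ultimately have "((\<lambda>x. prob (\<Union>p\<in>S. E m p x) / g x) \<longlongrightarrow> l v) at_top"
    by (rule Lim_transform_eventually)
  then show ?thesis ..
qed

lemma X_measurable[measurable]: "X i \<in> borel_measurable M"
  unfolding X_def
proof (rule measurable_quantile[OF F_cdf])
  show "0 \<le> max 0 (1 - P i w / \<omega> i) \<and> max 0 (1 - P i w / \<omega> i) \<le> 1" if "w \<in> space M" for w
    using P_range[OF that, of i] \<omega>_pos[of i] by simp
qed measurable

lemma X_ge: "0 < P i w \<Longrightarrow> k \<le> X i w"
  unfolding X_def using \<omega>_pos[of i] by (intro quantile_star_ge[OF F_cdf F_support]) auto

lemma less_X_iff:
  assumes "0 < P i w" and "k \<le> y"
  shows "y < X i w \<longleftrightarrow> P i w < \<omega> i * (1 - F y)"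
proof -
  have "y < X i w \<longleftrightarrow> F y < 1 - P i w / \<omega> i"
    unfolding X_def using assms \<omega>_pos[of i] by (intro less_quantile_star_iff[OF F_cdf F_support]) auto
  also have "\<dots> \<longleftrightarrow> P i w < \<omega> i * (1 - F y)"
    using \<omega>_pos[of i] by (simp add: field_simps)
  finally show ?thesis .
qed

text \<open>The tail probability of the sum relative to the rate \<open>g\<close>.\<close>

definition p :: "real \<Rightarrow> real" where
  "p x = prob {w \<in> space M. x \<le> (\<Sum>i\<in>UNIV. X i w)} / g x"

text \<open>A sum of at least \<open>x > 0\<close> has a summand above \<open>x / (n + 1)\<close>.\<close>

lemma p_upper: "\<forall>\<^sub>F x in at_top. p x \<le> U (\<lambda>i. \<omega> i * (1 - F (x * (1 / (real CARD('n) + 1))))) / g x"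
  using eventually_gt_at_top[of 0] eventually_ge_at_top[of "k * (real CARD('n) + 1)"]
proof eventually_elim
  case (elim x)
  let ?n = "real CARD('n)"
  have k: "k \<le> x * (1 / (?n + 1))" using elim by (simp add: field_simps)
  have "AE w in M. x \<le> (\<Sum>i\<in>UNIV. X i w) \<longrightarrow> (\<exists>i. P i w < \<omega> i * (1 - F (x * (1 / (?n + 1)))))"
    using AE_interior
  proof eventually_elim
    fix w assume w: "\<forall>i. 0 < P i w \<and> P i w < 1"
    show "x \<le> (\<Sum>i\<in>UNIV. X i w) \<longrightarrow> (\<exists>i. P i w < \<omega> i * (1 - F (x * (1 / (?n + 1)))))"
    proof (rule impI, rule ccontr)
      assume x: "x \<le> (\<Sum>i\<in>UNIV. X i w)" and "\<nexists>i. P i w < \<omega> i * (1 - F (x * (1 / (?n + 1))))"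
      then have "\<not> x * (1 / (?n + 1)) < X i w" for i
        using less_X_iff[of i w, OF _ k] w by blast
      then have "X i w \<le> x * (1 / (?n + 1))" for i by (simp only: not_less)
      then have "(\<Sum>i\<in>UNIV. X i w) \<le> (\<Sum>i\<in>(UNIV::'n set). x * (1 / (?n + 1)))" by (intro sum_mono)
      also have "\<dots> < x" using elim by (simp add: field_simps)
      finally show False using x by simp
    qed
  qed
  then have "prob {w \<in> space M. x \<le> (\<Sum>i\<in>UNIV. X i w)} \<le> U (\<lambda>i. \<omega> i * (1 - F (x * (1 / (?n + 1)))))"
    unfolding U_def by (intro finite_measure_mono_AE) (auto elim!: AE_mp)
  then show ?case unfolding p_def by (intro divide_right_mono less_imp_le[OF g_pos])
qed

text \<open>For large \<open>x\<close> a single summand above \<open>2 * x\<close> forces the sum above \<open>x\<close>: the others are bounded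
  below by the left end point \<open>k\<close> of the support, and the factor 2 absorbs them if \<open>k < 0\<close>.\<close>

lemma p_lower: "\<forall>\<^sub>F x in at_top. U (\<lambda>i. \<omega> i * (1 - F (x * 2))) / g x \<le> p x"
  using eventually_gt_at_top[of 0] eventually_ge_at_top[of k]
    eventually_ge_at_top[of "real CARD('n) * \<bar>k\<bar>"]
proof eventually_elim
  case (elim x)
  have k: "k \<le> x * 2" using elim by simp
  have "AE w in M. (\<exists>i. P i w < \<omega> i * (1 - F (x * 2))) \<longrightarrow> x \<le> (\<Sum>i\<in>UNIV. X i w)"
    using AE_interior
  proof eventually_elim
    fix w assume w: "\<forall>i. 0 < P i w \<and> P i w < 1"
    show "(\<exists>i. P i w < \<omega> i * (1 - F (x * 2))) \<longrightarrow> x \<le> (\<Sum>i\<in>UNIV. X i w)"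
    proof (rule impI, erule exE)
      fix i assume "P i w < \<omega> i * (1 - F (x * 2))"
      then have i: "x * 2 < X i w" using less_X_iff[of i w, OF _ k] w by blast
      have "(\<Sum>j\<in>UNIV - {i}. - \<bar>k\<bar>) \<le> (\<Sum>j\<in>UNIV - {i}. X j w)"
      proof (rule sum_mono)
        show "- \<bar>k\<bar> \<le> X j w" for j using X_ge[of j w] w by (smt (verit))
      qed
      then have "- (real CARD('n) * \<bar>k\<bar>) \<le> (\<Sum>j\<in>UNIV - {i}. X j w)"
        by (rule order_trans[rotated]) (simp add: mult_right_mono)
      moreover have "(\<Sum>j\<in>UNIV. X j w) = X i w + (\<Sum>j\<in>UNIV - {i}. X j w)"
        by (rule sum.remove) auto
      ultimately show "x \<le> (\<Sum>i\<in>UNIV. X i w)" using i elim by linarith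
    qed
  qed
  then have "U (\<lambda>i. \<omega> i * (1 - F (x * 2))) \<le> prob {w \<in> space M. x \<le> (\<Sum>i\<in>UNIV. X i w)}"
    unfolding U_def by (intro finite_measure_mono_AE) (auto elim!: AE_mp)
  then show ?case unfolding p_def by (intro divide_right_mono less_imp_le[OF g_pos])
qed

lemma U_tail_tendsto:
  assumes y: "y > 0"
  shows "((\<lambda>x. U (\<lambda>i. \<omega> i * (1 - F (x * y))) / g x) \<longlongrightarrow> b * y powr - (\<gamma> * \<beta>)) at_top"
proof -
  have sc: "filterlim (\<lambda>x. x * y) at_top at_top"
    using y by (intro filterlim_at_top_mult_tendsto_pos[OF tendsto_const _ filterlim_ident])
  have "((\<lambda>x. U (\<lambda>i. \<omega> i * (1 - F (x * y))) / g (x * y) * (g (x * y) / g x)) \<longlongrightarrow> b * y powr - (\<gamma> * \<beta>)) at_top"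
    unfolding g_def
    by (intro tendsto_mult U_weighted_tendsto filterlim_compose[OF tail_at_right sc] g_scale[OF y, unfolded g_def])
  moreover have "g (x * y) \<noteq> 0" for x using g_pos[of "x * y"] by simp
  ultimately show ?thesis by simp
qed

text \<open>Rounding each \<open>X i / x\<close> down to the grid of mesh \<open>1 / m\<close>, and cutting it off at 0 and 1, turns the
  event that the sum exceeds \<open>x\<close> into a Boolean combination of grid events. The rounding error is
  compensated by lowering the level from \<open>x\<close> to \<open>\<theta> * x\<close>.\<close>

lemma p_sandwich:
  assumes \<theta>: "0 < \<theta>" "\<theta> < 1"
  shows "\<exists>q h a. (\<forall>\<^sub>F x in at_top. p x \<le> q x) \<and> (\<forall>\<^sub>F x in at_top. q x \<le> p (\<theta> * x) * h x) \<and>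
    (q \<longlongrightarrow> a) at_top \<and> (h \<longlongrightarrow> \<theta> powr - (\<gamma> * \<beta>)) at_top"
proof -
  let ?n = "real CARD('n)"
  obtain m :: nat where m: "2 * ?n / (1 - \<theta>) < real m" using reals_Archimedean2 by blast
  have n1: "?n \<ge> 1" by (simp add: Suc_leI)
  have "0 < 2 * ?n / (1 - \<theta>)" using \<theta> n1 by simp
  then have m1: "m \<ge> 1" using m by linarith
  have nm: "2 * (?n / real m) < 1 - \<theta>" using m m1 \<theta> by (simp add: field_simps)
  \<comment> \<open>The sum of the rounded variables, computed from the set of grid events that occur. As
    \<open>n < m\<close>, the condition fails when none occurs.\<close>
  define \<phi> :: "('n \<times> nat) set \<Rightarrow> bool" where
    "\<phi> S \<longleftrightarrow> 1 - ?n / real m \<le> (\<Sum>i\<in>UNIV. real (card {j. (i, j) \<in> S}) / real m)" for S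
  let ?\<Lambda> = "UNIV \<times> {1..m} :: ('n \<times> nat) set"
  let ?Q = "\<lambda>x. {w \<in> space M. \<phi> {p \<in> ?\<Lambda>. w \<in> E m p x}}"
  have "\<not> \<phi> {}" using nm \<theta> n1 by (simp add: \<phi>_def)
  note bc = Boolean_combination_tendsto[of ?\<Lambda> "E m" g at_top \<phi>, OF _ E_events union_tendsto[OF m1] this]
  obtain a where a: "((\<lambda>x. prob (?Q x) / g x) \<longlongrightarrow> a) at_top" using bc(1) by auto
  have Q_events: "?Q x \<in> events" for x by (rule bc(2)) auto
  have main: "\<forall>\<^sub>F x in at_top. (AE w in M. (x \<le> (\<Sum>i\<in>UNIV. X i w) \<longrightarrow> w \<in> ?Q x) \<and>
      (w \<in> ?Q x \<longrightarrow> \<theta> * x \<le> (\<Sum>i\<in>UNIV. X i w)))"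
    using eventually_gt_at_top[of 0] eventually_ge_at_top[of "\<bar>k\<bar> * real m"]
  proof eventually_elim
    case (elim x)
    have km: "\<bar>k\<bar> \<le> x / real m" using elim m1 by (simp add: field_simps)
    show ?case
      using AE_interior AE_space
    proof eventually_elim
      fix w assume w: "\<forall>i. 0 < P i w \<and> P i w < 1" "w \<in> space M"
      define Y where "Y i = X i w / x" for i
      define N where "N i = real (card {j \<in> {1..m}. real j / real m < Y i}) / real m" for i
      have sets: "{j. (i, j) \<in> {p \<in> ?\<Lambda>. w \<in> E m p x}} = {j \<in> {1..m}. real j / real m < Y i}" for i
      proof -
        have "w \<in> E m (i, j) x \<longleftrightarrow> real j / real m < Y i" if "j \<in> {1..m}" for j
        proof -
          have "x / real m \<le> x * (real j / real m)"
            using that elim m1 by (simp add: field_simps)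
          then have "x * (real j / real m) < X i w \<longleftrightarrow> w \<in> E m (i, j) x"
            using less_X_iff[of i w "x * (real j / real m)"] km w by (auto simp: E_def)
          then show ?thesis using elim by (simp add: Y_def field_simps)
        qed
        then show ?thesis by auto
      qed
      have Q: "w \<in> ?Q x \<longleftrightarrow> 1 - ?n / real m \<le> (\<Sum>i\<in>UNIV. N i)"
      proof -
        have "w \<in> ?Q x \<longleftrightarrow> \<phi> {p \<in> ?\<Lambda>. w \<in> E m p x}"
          using w(2) by (simp only: mem_Collect_eq simp_thms)
        then show ?thesis by (simp only: \<phi>_def sets N_def)
      qed
      have N_up: "N i \<le> max 0 (Y i)" and N_lo: "min (Y i) 1 \<le> N i + 1 / real m" for i
        unfolding N_def using grid_count[OF m1, of "Y i"] by auto
      have N_nonneg: "0 \<le> N i" for i by (simp add: N_def)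
      have sumY: "(\<Sum>i\<in>UNIV. X i w) = x * (\<Sum>i\<in>UNIV. Y i)"
        using elim by (simp add: Y_def sum_distrib_left)
      show "(x \<le> (\<Sum>i\<in>UNIV. X i w) \<longrightarrow> w \<in> ?Q x) \<and> (w \<in> ?Q x \<longrightarrow> \<theta> * x \<le> (\<Sum>i\<in>UNIV. X i w))"
      proof (intro conjI impI)
        assume "x \<le> (\<Sum>i\<in>UNIV. X i w)"
        then have Y1: "1 \<le> (\<Sum>i\<in>UNIV. Y i)" using elim unfolding sumY by simp
        show "w \<in> ?Q x"
        proof (cases "\<exists>i. Y i > 1")
          case True
          then obtain i where "Y i > 1" by blast
          then have "1 - 1 / real m \<le> N i" using N_lo[of i] by simp
          also have "\<dots> \<le> (\<Sum>i\<in>UNIV. N i)" using N_nonneg by (intro member_le_sum) auto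
          finally have "1 - 1 / real m \<le> (\<Sum>i\<in>UNIV. N i)" .
          moreover have "1 / real m \<le> ?n / real m" using n1 by (intro divide_right_mono) auto
          ultimately show ?thesis unfolding Q by linarith
        next
          case False
          have "1 \<le> (\<Sum>i\<in>UNIV. N i + 1 / real m)"
            using Y1 False N_lo by (intro order_trans[OF Y1] sum_mono) (smt (verit))
          then show ?thesis unfolding Q by (simp add: sum.distrib)
        qed
      next
        assume "w \<in> ?Q x"
        then have "1 - ?n / real m \<le> (\<Sum>i\<in>UNIV. N i)" unfolding Q .
        also have "\<dots> \<le> (\<Sum>i\<in>UNIV. Y i + 1 / real m)"
        proof (rule sum_mono)
          fix i
          have "- (x / real m) \<le> X i w" using X_ge[of i w] w km by (smt (verit))
          then have "- (1 / real m) \<le> Y i" using elim by (simp add: Y_def field_simps)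
          then show "N i \<le> Y i + 1 / real m" using N_up[of i] by (smt (verit) divide_nonneg_nonneg of_nat_0_le_iff)
        qed
        finally have "1 - 2 * (?n / real m) \<le> (\<Sum>i\<in>UNIV. Y i)" by (simp add: sum.distrib)
        then have "\<theta> \<le> (\<Sum>i\<in>UNIV. Y i)" using nm by linarith
        then have "x * \<theta> \<le> x * (\<Sum>i\<in>UNIV. Y i)" using elim by (intro mult_left_mono) auto
        then show "\<theta> * x \<le> (\<Sum>i\<in>UNIV. X i w)" unfolding sumY by (simp add: mult.commute)
      qed
    qed
  qed
  have "\<forall>\<^sub>F x in at_top. p x \<le> prob (?Q x) / g x"
    using main
  proof eventually_elim
    case (elim x)
    then have "prob {w \<in> space M. x \<le> (\<Sum>i\<in>UNIV. X i w)} \<le> prob (?Q x)"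
      by (intro finite_measure_mono_AE Q_events) (auto elim!: AE_mp)
    then show ?case unfolding p_def by (intro divide_right_mono less_imp_le[OF g_pos])
  qed
  moreover have "\<forall>\<^sub>F x in at_top. prob (?Q x) / g x \<le> p (\<theta> * x) * (g (x * \<theta>) / g x)"
    using main
  proof eventually_elim
    case (elim x)
    then have "prob (?Q x) \<le> prob {w \<in> space M. \<theta> * x \<le> (\<Sum>i\<in>UNIV. X i w)}"
      by (intro finite_measure_mono_AE) (auto elim!: AE_mp)
    then have "prob (?Q x) / g x \<le> prob {w \<in> space M. \<theta> * x \<le> (\<Sum>i\<in>UNIV. X i w)} / g x"
      by (intro divide_right_mono less_imp_le[OF g_pos])
    also have "\<dots> = p (\<theta> * x) * (g (x * \<theta>) / g x)"
      using g_pos[of "\<theta> * x"] by (simp add: p_def mult.commute)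
    finally show ?case .
  qed
  ultimately show ?thesis
    using a g_scale[OF \<theta>(1)]
    by (intro exI[of _ "\<lambda>x. prob (?Q x) / g x"] exI[of _ "\<lambda>x. g (x * \<theta>) / g x"] exI[of _ a]) simp
qed

text \<open>The bounds on the limit are crude, but they differ from \<open>b\<close> only by factors that tend to 1 as
  \<open>\<gamma> \<down> 0\<close>.\<close>

lemma p_converges:
  "\<exists>L. (p \<longlongrightarrow> L) at_top \<and> b * 2 powr - (\<gamma> * \<beta>) \<le> L \<and>
    L \<le> b * (1 / (real CARD('n) + 1)) powr - (\<gamma> * \<beta>)"
proof -
  let ?y = "1 / (real CARD('n) + 1)"
  have y: "?y > 0" by (simp add: add_pos_nonneg)
  have "\<forall>\<^sub>F x in at_top. p x \<le> b * ?y powr - (\<gamma> * \<beta>) + 1"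
    using p_upper order_tendstoD(2)[OF U_tail_tendsto[OF y], of "b * ?y powr - (\<gamma> * \<beta>) + 1"]
    by (auto elim: eventually_elim2)
  moreover have "0 \<le> p x" for x unfolding p_def using g_pos[of x] by simp
  ultimately obtain L where L: "(p \<longlongrightarrow> L) at_top"
    using self_similar_sandwich_converges[OF _ _ p_sandwich] by blast
  have "b * 2 powr - (\<gamma> * \<beta>) \<le> L"
    using tendsto_le[OF _ L U_tail_tendsto p_lower] by simp
  moreover have "L \<le> b * ?y powr - (\<gamma> * \<beta>)"
    using tendsto_le[OF _ U_tail_tendsto[OF y] L p_upper] by simp
  ultimately show ?thesis using L by blast
qed

section \<open>Ratio of the rejection probabilities\<close>

text \<open>For small \<open>\<alpha>\<close> the combination test rejects iff the sum of the \<open>X i\<close> is at least \<open>n * \<xi>\<close>, where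
  \<open>1 - F \<xi> = \<alpha> * n powr (\<gamma> - 1)\<close>. Relative to \<open>G i0 \<alpha>\<close> both rejection probabilities then
  carry the same factor \<open>n powr - \<beta>\<close>, and the ratio tends to \<open>L / b\<close>.\<close>

lemma ratio_tendsto:
  assumes cont: "continuous_on {k..} F" and strict: "strict_mono_on {k..} F"
  shows "\<exists>R. ((\<lambda>\<alpha>. prob {w \<in> space M. P_comb \<gamma> F \<omega> (\<lambda>i. P i w) \<le> \<alpha>}
      / prob {w \<in> space M. P_bon \<omega> (\<lambda>i. P i w) \<le> \<alpha>}) \<longlongrightarrow> R) (at_right 0) \<and>
    2 powr - (\<gamma> * \<beta>) \<le> R \<and> R \<le> (1 / (real CARD('n) + 1)) powr - (\<gamma> * \<beta>)"
proof -
  define n where "n = real CARD('n)"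
  have n1: "n \<ge> 1" by (simp add: n_def Suc_leI)
  define a where "a \<alpha> = \<alpha> * n powr (\<gamma> - 1)" for \<alpha>
  define \<xi> where "\<xi> \<alpha> = (SOME x. k < x \<and> F x = 1 - a \<alpha>)" for \<alpha>
  have small: "\<forall>\<^sub>F \<alpha> in at_right 0. 0 < \<alpha> \<and> \<alpha> < (1::real)"
    using eventually_at_right_real[of 0 "1::real"] by (auto elim: eventually_mono)
  have a_small: "\<forall>\<^sub>F \<alpha> in at_right 0. 0 < a \<alpha> \<and> a \<alpha> < 1 - F B" for B
  proof -
    have "(a \<longlongrightarrow> 0 * n powr (\<gamma> - 1)) (at_right 0)" unfolding a_def by (intro tendsto_intros)
    then have "\<forall>\<^sub>F \<alpha> in at_right 0. a \<alpha> < 1 - F B"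
      using reg_varying_less_1[OF F_rv, of B] by (intro order_tendstoD(2)) auto
    with small show ?thesis by eventually_elim (use n1 in \<open>simp add: a_def\<close>)
  qed
  have \<xi>: "k < \<xi> \<alpha> \<and> F (\<xi> \<alpha>) = 1 - a \<alpha>" if "0 < a \<alpha>" "a \<alpha> < 1 - F k" for \<alpha>
    unfolding \<xi>_def
  proof (rule someI_ex)
    have "\<forall>\<^sub>F x in at_top. 1 - a \<alpha> < F x \<and> k < x"
      using order_tendstoD(1)[OF is_cdf_at_top[OF F_cdf], of "1 - a \<alpha>"] that eventually_gt_at_top[of k]
      by (simp add: eventually_conj_iff)
    then obtain z where z: "1 - a \<alpha> < F z" "k < z"
      using eventually_happens'[OF trivial_limit_at_top_linorder] by blast
    have "continuous_on {k..z} F" by (rule continuous_on_subset[OF cont]) auto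
    moreover have "F k \<le> 1 - a \<alpha>" "1 - a \<alpha> \<le> F z" "k \<le> z" using that z by auto
    ultimately obtain x where "k \<le> x" "F x = 1 - a \<alpha>"
      using IVT'[of F k "1 - a \<alpha>" z] by blast
    then show "\<exists>x. k < x \<and> F x = 1 - a \<alpha>" using that by (intro exI[of _ x]) (auto simp: less_le)
  qed
  have \<xi>_ev: "\<forall>\<^sub>F \<alpha> in at_right 0. k < \<xi> \<alpha> \<and> F (\<xi> \<alpha>) = 1 - a \<alpha>"
    using a_small[of k] by eventually_elim (use \<xi> in blast)
  have \<xi>_top: "filterlim \<xi> at_top (at_right 0)"
    unfolding filterlim_at_top
  proof
    fix B show "\<forall>\<^sub>F \<alpha> in at_right 0. B \<le> \<xi> \<alpha>"
      using \<xi>_ev a_small[of B]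
    proof eventually_elim
      case (elim \<alpha>)
      then show ?case using is_cdf_mono[OF F_cdf, of "\<xi> \<alpha>" B] by (cases "B \<le> \<xi> \<alpha>") auto
    qed
  qed
  have \<xi>n_top: "filterlim (\<lambda>\<alpha>. \<xi> \<alpha> * n) at_top (at_right 0)"
    using n1 by (intro filterlim_at_top_mult_tendsto_pos[OF tendsto_const _ \<xi>_top]) simp
  have num_eq: "\<forall>\<^sub>F \<alpha> in at_right 0. p (\<xi> \<alpha> * n) * (g (\<xi> \<alpha> * n) / g (\<xi> \<alpha>))
      * (G i0 (\<alpha> * n powr (\<gamma> - 1)) / G i0 \<alpha>) = prob {w \<in> space M. P_comb \<gamma> F \<omega> (\<lambda>i. P i w) \<le> \<alpha>} / G i0 \<alpha>"
    using small \<xi>_ev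
  proof eventually_elim
    case (elim \<alpha>)
    have "P_comb \<gamma> F \<omega> (\<lambda>i. P i w) \<le> \<alpha> \<longleftrightarrow> \<xi> \<alpha> * n \<le> (\<Sum>i\<in>UNIV. X i w)" for w
    proof -
      define s where "s = (1 / n) * (\<Sum>i\<in>UNIV. X i w)"
      have "P_comb \<gamma> F \<omega> (\<lambda>i. P i w) = min 1 (n powr (1 - \<gamma>) * (1 - F s))"
        by (simp add: P_comb_def comb_stat_def X_def n_def s_def)
      then have "P_comb \<gamma> F \<omega> (\<lambda>i. P i w) \<le> \<alpha> \<longleftrightarrow> n powr (1 - \<gamma>) * (1 - F s) \<le> \<alpha>"
        using elim by auto
      also have "\<dots> \<longleftrightarrow> 1 - F s \<le> a \<alpha>"
      proof -
        have "n powr (\<gamma> - 1) * n powr (1 - \<gamma>) = 1" using n1 by (simp flip: powr_add)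
        then have "n powr (1 - \<gamma>) * a \<alpha> = \<alpha>" by (simp add: a_def mult_ac)
        moreover have "n powr (1 - \<gamma>) > 0" using n1 by simp
        ultimately show ?thesis by (metis mult_le_cancel_left_pos)
      qed
      also have "\<dots> \<longleftrightarrow> F (\<xi> \<alpha>) \<le> F s" using elim by auto
      also have "\<dots> \<longleftrightarrow> \<xi> \<alpha> \<le> s"
      proof
        assume le: "F (\<xi> \<alpha>) \<le> F s"
        show "\<xi> \<alpha> \<le> s"
        proof (rule ccontr)
          assume "\<not> \<xi> \<alpha> \<le> s"
          then have "F (max k s) < F (\<xi> \<alpha>)"
            using elim by (intro strict_mono_onD[OF strict]) auto
          moreover have "F s \<le> F (max k s)" by (intro is_cdf_mono[OF F_cdf]) simp
          ultimately show False using le by simp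
        qed
      qed (rule is_cdf_mono[OF F_cdf])
      also have "\<dots> \<longleftrightarrow> \<xi> \<alpha> * n \<le> (\<Sum>i\<in>UNIV. X i w)"
        using n1 by (simp add: s_def field_simps)
      finally show ?thesis .
    qed
    then have "prob {w \<in> space M. P_comb \<gamma> F \<omega> (\<lambda>i. P i w) \<le> \<alpha>} = p (\<xi> \<alpha> * n) * g (\<xi> \<alpha> * n)"
      using g_pos[of "\<xi> \<alpha> * n"] by (simp add: p_def)
    moreover have "g (\<xi> \<alpha>) = G i0 (\<alpha> * n powr (\<gamma> - 1))" using elim by (simp add: g_def a_def)
    ultimately show ?case using g_pos[of "\<xi> \<alpha>"] by simp
  qed
  obtain L where L: "(p \<longlongrightarrow> L) at_top" "b * 2 powr - (\<gamma> * \<beta>) \<le> L"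
    "L \<le> b * (1 / (n + 1)) powr - (\<gamma> * \<beta>)"
    using p_converges unfolding n_def by blast
  have "((\<lambda>\<alpha>. p (\<xi> \<alpha> * n) * (g (\<xi> \<alpha> * n) / g (\<xi> \<alpha>)) * (G i0 (\<alpha> * n powr (\<gamma> - 1)) / G i0 \<alpha>))
      \<longlongrightarrow> L * n powr - (\<gamma> * \<beta>) * (n powr (\<gamma> - 1)) powr \<beta>) (at_right 0)"
    using n1
    by (intro tendsto_mult filterlim_compose[OF L(1) \<xi>n_top] filterlim_compose[OF g_scale \<xi>_top] G_rv) auto
  also have "L * n powr - (\<gamma> * \<beta>) * (n powr (\<gamma> - 1)) powr \<beta> = L * n powr - \<beta>"
    by (simp add: powr_powr algebra_simps flip: powr_add)
  finally have num: "((\<lambda>\<alpha>. prob {w \<in> space M. P_comb \<gamma> F \<omega> (\<lambda>i. P i w) \<le> \<alpha>} / G i0 \<alpha>)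
      \<longlongrightarrow> L * n powr - \<beta>) (at_right 0)"
    by (rule Lim_transform_eventually[OF _ num_eq])
  have den_eq: "\<forall>\<^sub>F \<alpha> in at_right 0. U (\<lambda>i. \<omega> i * (\<alpha> * (1 / n))) / G i0 (\<alpha> * (1 / n))
      * (G i0 (\<alpha> * (1 / n)) / G i0 \<alpha>) = prob {w \<in> space M. P_bon \<omega> (\<lambda>i. P i w) \<le> \<alpha>} / G i0 \<alpha>"
    using small
  proof eventually_elim
    case (elim \<alpha>)
    have iff: "P_bon \<omega> (\<lambda>i. P i w) \<le> \<alpha> \<longleftrightarrow> (\<exists>i. P i w \<le> \<omega> i * (\<alpha> * (1 / n)))" for w
    proof -
      have "P_bon \<omega> (\<lambda>i. P i w) \<le> \<alpha> \<longleftrightarrow> n * (MIN i. P i w / \<omega> i) \<le> \<alpha>"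
        using elim by (auto simp: P_bon_def n_def)
      also have "\<dots> \<longleftrightarrow> (MIN i. P i w / \<omega> i) \<le> \<alpha> * (1 / n)"
        using n1 by (simp add: field_simps)
      also have "\<dots> \<longleftrightarrow> (\<exists>i. P i w / \<omega> i \<le> \<alpha> * (1 / n))"
        by (subst Min_le_iff) auto
      also have "\<dots> \<longleftrightarrow> (\<exists>i. P i w \<le> \<omega> i * (\<alpha> * (1 / n)))"
        using \<omega>_pos by (simp add: pos_divide_le_eq mult.commute)
      finally show ?thesis .
    qed
    have "AE w in M. \<forall>i. P i w \<noteq> \<omega> i * (\<alpha> * (1 / n))"
      by (intro AE_all_countable[THEN iffD2] allI AE_neq)
    then have "AE w in M. w \<in> {w \<in> space M. \<exists>i. P i w \<le> \<omega> i * (\<alpha> * (1 / n))} \<longleftrightarrow>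
        w \<in> {w \<in> space M. \<exists>i. P i w < \<omega> i * (\<alpha> * (1 / n))}"
      by eventually_elim (auto simp: less_le)
    then have "prob {w \<in> space M. P_bon \<omega> (\<lambda>i. P i w) \<le> \<alpha>} = U (\<lambda>i. \<omega> i * (\<alpha> * (1 / n)))"
      unfolding iff U_def by (intro finite_measure_eq_AE) auto
    moreover have "G i0 (\<alpha> * (1 / n)) > 0" using elim n1 by (intro G_pos) simp
    ultimately show ?case by simp
  qed
  have Tn: "filterlim (\<lambda>\<alpha>. \<alpha> * (1 / n)) (at_right 0) (at_right (0::real))"
    unfolding filterlim_at
  proof
    show "((\<lambda>\<alpha>. \<alpha> * (1 / n)) \<longlongrightarrow> 0) (at_right (0::real))"
      by (rule tendsto_mult_left_zero[OF tendsto_ident_at])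
    show "\<forall>\<^sub>F \<alpha> in at_right 0. \<alpha> * (1 / n) \<in> {0<..} \<and> \<alpha> * (1 / n) \<noteq> 0"
      using small by eventually_elim (use n1 in simp)
  qed
  have "((\<lambda>\<alpha>. U (\<lambda>i. \<omega> i * (\<alpha> * (1 / n))) / G i0 (\<alpha> * (1 / n)) * (G i0 (\<alpha> * (1 / n)) / G i0 \<alpha>))
      \<longlongrightarrow> b * (1 / n) powr \<beta>) (at_right 0)"
    using n1 by (intro tendsto_mult U_weighted_tendsto Tn G_rv) auto
  also have "(1 / n) powr \<beta> = n powr - \<beta>" using n1 by (simp add: powr_minus_divide powr_divide)
  finally have den: "((\<lambda>\<alpha>. prob {w \<in> space M. P_bon \<omega> (\<lambda>i. P i w) \<le> \<alpha>} / G i0 \<alpha>)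
      \<longlongrightarrow> b * n powr - \<beta>) (at_right 0)"
    by (rule Lim_transform_eventually[OF _ den_eq])
  have "n powr - \<beta> > 0" using n1 by simp
  then have "((\<lambda>\<alpha>. prob {w \<in> space M. P_comb \<gamma> F \<omega> (\<lambda>i. P i w) \<le> \<alpha>} / G i0 \<alpha>
      / (prob {w \<in> space M. P_bon \<omega> (\<lambda>i. P i w) \<le> \<alpha>} / G i0 \<alpha>))
      \<longlongrightarrow> L * n powr - \<beta> / (b * n powr - \<beta>)) (at_right 0)"
    using b_pos by (intro tendsto_divide num den) simp
  moreover have "\<forall>\<^sub>F \<alpha> in at_right 0. prob {w \<in> space M. P_comb \<gamma> F \<omega> (\<lambda>i. P i w) \<le> \<alpha>} / G i0 \<alpha>
      / (prob {w \<in> space M. P_bon \<omega> (\<lambda>i. P i w) \<le> \<alpha>} / G i0 \<alpha>)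
      = prob {w \<in> space M. P_comb \<gamma> F \<omega> (\<lambda>i. P i w) \<le> \<alpha>}
      / prob {w \<in> space M. P_bon \<omega> (\<lambda>i. P i w) \<le> \<alpha>}"
    using small by eventually_elim (use G_pos in fastforce)
  ultimately have "((\<lambda>\<alpha>. prob {w \<in> space M. P_comb \<gamma> F \<omega> (\<lambda>i. P i w) \<le> \<alpha>}
      / prob {w \<in> space M. P_bon \<omega> (\<lambda>i. P i w) \<le> \<alpha>}) \<longlongrightarrow> L * n powr - \<beta> / (b * n powr - \<beta>)) (at_right 0)"
    by (rule Lim_transform_eventually)
  then have "((\<lambda>\<alpha>. prob {w \<in> space M. P_comb \<gamma> F \<omega> (\<lambda>i. P i w) \<le> \<alpha>}
      / prob {w \<in> space M. P_bon \<omega> (\<lambda>i. P i w) \<le> \<alpha>}) \<longlongrightarrow> L / b) (at_right 0)"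
    using \<open>n powr - \<beta> > 0\<close> by simp
  moreover have "2 powr - (\<gamma> * \<beta>) \<le> L / b" "L / b \<le> (1 / (n + 1)) powr - (\<gamma> * \<beta>)"
    using L(2,3) b_pos by (simp_all add: field_simps)
  ultimately show ?thesis unfolding n_def by blast
qed

end

end

theorem theorem4p5:
  fixes M :: "'a measure"
    and P :: "'n::finite \<Rightarrow> 'a \<Rightarrow> real"
    and \<omega> :: "'n \<Rightarrow> real"
    and F :: "real \<Rightarrow> real \<Rightarrow> real"
  assumes "prob_space M"
    and "\<And>i. P i \<in> borel_measurable M"
    and "\<And>i x. x \<in> space M \<Longrightarrow> P i x \<in> {0..1}"
    and "\<And>i. \<omega> i > 0"
    and "(\<Sum>i\<in>UNIV. \<omega> i) = real CARD('n)"
    and "\<And>i. continuous_on UNIV (law_cdf M (P i))"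
    and "\<exists>C. copula_of M (\<lambda>i x. 1 - P i x) C \<and> MRV_copula C"
    and "\<And>i j. i \<in> dominating M P \<Longrightarrow> j \<in> dominating M P \<Longrightarrow> i \<noteq> j \<Longrightarrow>
           \<exists>L>0. ((\<lambda>t. measure M {x \<in> space M. P i x < t} / measure M {x \<in> space M. P j x < t})
                    \<longlongrightarrow> L) (at_right 0)"
    and "\<exists>i\<in>dominating M P. \<exists>F0\<in>reg_varying 1. \<exists>\<beta>. 0 < \<beta> \<and> \<beta> \<le> 1 \<and>
           law_cdf M (\<lambda>x. quantile F0 (1 - P i x)) \<in> reg_varying \<beta>"
    and "\<And>\<gamma>. \<gamma> > 0 \<Longrightarrow> F \<gamma> \<in> reg_varying_star \<gamma>"
  shows "\<exists>R :: real \<Rightarrow> real.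
           (\<forall>\<gamma>>0. ((\<lambda>\<alpha>. measure M {x \<in> space M. P_comb \<gamma> (F \<gamma>) \<omega> (\<lambda>i. P i x) \<le> \<alpha>}
                          / measure M {x \<in> space M. P_bon \<omega> (\<lambda>i. P i x) \<le> \<alpha>})
                    \<longlongrightarrow> R \<gamma>) (at_right 0)) \<and>
           (R \<longlongrightarrow> 1) (at_right 0)"
proof -
  interpret continuous_pvalues M P
    by (intro continuous_pvalues.intro continuous_pvalues_axioms.intro assms)
  obtain C where C: "copula_of M (\<lambda>i x. 1 - P i x) C" "MRV_copula C" using assms(7) by blast
  obtain l :: "('n \<Rightarrow> real) \<Rightarrow> real" where l: "\<And>(A :: real filter) g u v. filterlim g (at_right 0) A \<Longrightarrow>
      (\<And>i x. 0 \<le> u i x \<and> u i x \<le> 1) \<Longrightarrow> (\<And>i. 0 \<le> v i) \<Longrightarrow>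
      (\<And>i. ((\<lambda>x. u i x / g x) \<longlongrightarrow> v i) A) \<Longrightarrow>
      ((\<lambda>x. copula_D C (\<chi> i. u i x) / g x) \<longlongrightarrow> l v) A"
    using MRV_copula_tendsto[OF C(2)] by blast
  obtain i0 F0 \<beta> where i0: "i0 \<in> dominating M P" and F0: "F0 \<in> reg_varying 1"
    and \<beta>: "law_cdf M (\<lambda>x. quantile F0 (1 - P i0 x)) \<in> reg_varying \<beta>"
    using assms(9) by blast
  note tail = tail_index[OF F0 \<beta>]
  have "\<forall>i. \<exists>c\<ge>0. ((\<lambda>t. G i t / G i0 t) \<longlongrightarrow> c) (at_right 0)"
    by (intro allI relative_tail_tendsto[OF _ i0 tail(1)]) (simp_all add: G_def assms(8))
  from choice[OF this] obtain c
    where c: "\<And>i. c i \<ge> 0" "\<And>i. ((\<lambda>t. G i t / G i0 t) \<longlongrightarrow> c i) (at_right 0)" by blast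
  interpret weighted_tails M P \<omega> i0 \<beta> c l
  proof
    fix A :: "real filter" and g :: "real \<Rightarrow> real" and t :: "'n \<Rightarrow> real \<Rightarrow> real" and v
    assume "filterlim g (at_right 0) A" "\<And>i. 0 \<le> v i" "\<And>i. ((\<lambda>x. G i (t i x) / g x) \<longlongrightarrow> v i) A"
    then show "((\<lambda>x. U (\<lambda>i. t i x) / g x) \<longlongrightarrow> l v) A"
      unfolding U_eq_copula_D[OF C(1)] using G_bounds by (intro l) auto
  qed (use assms(4) tail c in auto)
  let ?ratio = "\<lambda>\<gamma> \<alpha>. measure M {x \<in> space M. P_comb \<gamma> (F \<gamma>) \<omega> (\<lambda>i. P i x) \<le> \<alpha>}
      / measure M {x \<in> space M. P_bon \<omega> (\<lambda>i. P i x) \<le> \<alpha>}"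
  have "\<forall>\<gamma>\<in>{0<..}. \<exists>R. (?ratio \<gamma> \<longlongrightarrow> R) (at_right 0) \<and>
    2 powr - (\<gamma> * \<beta>) \<le> R \<and> R \<le> (1 / (real CARD('n) + 1)) powr - (\<gamma> * \<beta>)"
  proof
    fix \<gamma> :: real assume "\<gamma> \<in> {0<..}"
    then have "F \<gamma> \<in> reg_varying_star \<gamma>" using assms(10) by simp
    then obtain k where "F \<gamma> \<in> reg_varying \<gamma>" "cdf_support (F \<gamma>) = {k..}"
      "continuous_on {k..} (F \<gamma>)" "strict_mono_on {k..} (F \<gamma>)"
      unfolding reg_varying_star_def by auto
    then show "\<exists>R. (?ratio \<gamma> \<longlongrightarrow> R) (at_right 0) \<and>
        2 powr - (\<gamma> * \<beta>) \<le> R \<and> R \<le> (1 / (real CARD('n) + 1)) powr - (\<gamma> * \<beta>)"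
      by (rule ratio_tendsto)
  qed
  from bchoice[OF this] obtain R where R: "\<And>\<gamma>. \<gamma> > 0 \<Longrightarrow> (?ratio \<gamma> \<longlongrightarrow> R \<gamma>) (at_right 0)"
    "\<And>\<gamma>. \<gamma> > 0 \<Longrightarrow> 2 powr - (\<gamma> * \<beta>) \<le> R \<gamma>"
    "\<And>\<gamma>. \<gamma> > 0 \<Longrightarrow> R \<gamma> \<le> (1 / (real CARD('n) + 1)) powr - (\<gamma> * \<beta>)"
    by auto
  have to_1: "((\<lambda>\<gamma>. y powr - (\<gamma> * \<beta>)) \<longlongrightarrow> 1) (at_right 0)" if "y > 0" for y :: real
  proof -
    have "((\<lambda>\<gamma>. y powr - (\<gamma> * \<beta>)) \<longlongrightarrow> y powr - (0 * \<beta>)) (at_right 0)"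
      using that by (intro tendsto_intros) auto
    then show ?thesis using that by simp
  qed
  have "(R \<longlongrightarrow> 1) (at_right 0)"
  proof (rule tendsto_sandwich[OF _ _ to_1 to_1])
    show "\<forall>\<^sub>F \<gamma> in at_right 0. 2 powr - (\<gamma> * \<beta>) \<le> R \<gamma>"
      using eventually_at_right_less[of "0::real"] by eventually_elim (rule R)
    show "\<forall>\<^sub>F \<gamma> in at_right 0. R \<gamma> \<le> (1 / (real CARD('n) + 1)) powr - (\<gamma> * \<beta>)"
      using eventually_at_right_less[of "0::real"] by eventually_elim (rule R)
  qed (simp_all add: add_pos_nonneg)
  with R(1) show ?thesis by blast
qed

end
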